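(* Let $\kappa>\omega_1$ be regular. Then $\mathsf{wDRP}_{\mathsf{IA}}(\mathcal{S}_{\mathsf{lift}}(\kappa))$ implies the diagonal stationary reflection principle $\mathsf{DSR}(\omega_1,S^\kappa_\omega)$.
   Context: $[Y]^\omega$ denotes the set of countable subsets of $Y$, and $S^\kappa_\omega=\{\alpha<\kappa\mid\mathrm{cf}(\alpha)=\omega\}$. For $A\subseteq\kappa$ unbounded, $\mathsf{lift}(A,[H_\kappa]^\omega)=\{x\in[H_\kappa]^\omega\mid\sup(x\cap\kappa)\in A\}$, and $$\mathcal{S}_{\mathsf{lift}}(\kappa)=\{\mathsf{lift}(A,[H_\kappa]^\omega)\cap C\mid A\subseteq S^\kappa_\omega\text{ is stationary in }\kappa\text{ and }C\subseteq[H_\kappa]^\omega\text{ is club}\}.$$ A set $N$ is internally approachable if it is the union of a continuous $\in$-chain $\langle N_\alpha\mid\alpha<\omega_1\rangle$ of countable sets ($N_\alpha\in N_{\alpha+1}$, with unions at limits) such that for every $\alpha<\omega_1$, $\langle N_\xi\mid\xi<\alpha\rangle\in N$. For a collection $\mathcal{S}\subseteq\mathcal{P}([H_\kappa]^\omega)$ of stationary sets, $\mathsf{wDRP}_{\mathsf{IA}}(\mathcal{S})$ says: whenever $\theta$ is large enough that $\mathcal{S}\subseteq H_\theta$, there are stationarily many $W\in[H_\theta]^{\omega_1}$ such that (a) $W\cap H_\kappa$ is internally approachable, and (b) for every $S\in W\cap\mathcal{S}$, $S\cap[W\cap H_\kappa]^\omega$ is stationary in $[W\cap H_\kappa]^\omega$.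 For a stationary $S\subseteq\kappa$, $\mathsf{DSR}(\omega_1,S)$ says that whenever $\langle S_{\alpha,i}\mid\alpha<\kappa,\ i<j_\alpha\rangle$ is a sequence of stationary subsets of $S$, where $j_\alpha\le\omega_1$ for every $\alpha<\kappa$, there are an ordinal $\gamma<\kappa$ of uncountable cofinality and a club $F\subseteq\gamma$ such that for every $\alpha\in F$ and every $i<j_\alpha$, $S_{\alpha,i}\cap\gamma$ is stationary in $\gamma$. *)

theory Defs
  imports Main "HOL-Library.Equipollence"
begin

text \<open>
  A type of class \<open>zfc\<close> is a universe of sets satisfying the axioms of ZFC. Its subsets, of type
  \<open>'a set\<close>, play the role of classes, and the schemas of separation and replacement are stated with
  quantification over predicates and functions. Choice comes from HOL: every family of nonempty
  sets has an HOL choice function, and by replacement its restriction to a set is a set.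
  By separation, every HOL subset of \<open>elts x\<close> is of the form \<open>elts y\<close>; hence
  families of elements or subsets of a set are represented by HOL sets and HOL functions wherever
  they do not themselves have to be members of a set.
\<close>

class zfc =
  fixes elts :: "'a \<Rightarrow> 'a set"
  assumes extensionality: "elts x = elts y \<Longrightarrow> x = y"
    and foundation: "wf {(x, y). x \<in> elts y}"
    and pairing: "\<exists>z. elts z = {x, y}"
    and union: "\<exists>y. elts y = (\<Union>z\<in>elts x. elts z)"
    and powerset: "\<exists>y. elts y = {z. elts z \<subseteq> elts x}"
    and infinity: "\<exists>x. (\<exists>e\<in>elts x. elts e = {}) \<and>
                       (\<forall>y\<in>elts x. \<exists>s\<in>elts x. elts s = insert y (elts y))"
    and separation: "\<exists>y. elts y = {z \<in> elts x. P z}"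
    and replacement: "\<exists>y. elts y = f ` elts x"

text \<open>Only meaningful if \<open>X\<close> is the extension of a set, i.e. not a proper class.\<close>

definition vset :: "'v::zfc set \<Rightarrow> 'v" where
  "vset X = (THE x. elts x = X)"

definition vpair :: "'v::zfc \<Rightarrow> 'v \<Rightarrow> 'v" where
  "vpair x y = vset {vset {x}, vset {x, y}}"

definition vseq :: "('v::zfc \<Rightarrow> 'v) \<Rightarrow> 'v \<Rightarrow> 'v" where
  "vseq f \<alpha> = vset ((\<lambda>\<xi>. vpair \<xi> (f \<xi>)) ` elts \<alpha>)"


section \<open>Ordinals and cofinality\<close>

definition Trans :: "'v::zfc \<Rightarrow> bool" where
  "Trans x \<longleftrightarrow> (\<forall>y\<in>elts x. elts y \<subseteq> elts x)"

text \<open>Von Neumann ordinals: \<open>\<alpha> < \<beta>\<close> is \<open>\<alpha> \<in> elts \<beta>\<close>, and \<open>\<alpha> \<le> \<beta>\<close> is \<open>elts \<alpha> \<subseteq> elts \<beta>\<close>.\<close>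

definition Ord :: "'v::zfc \<Rightarrow> bool" where
  "Ord \<alpha> \<longleftrightarrow> Trans \<alpha> \<and> (\<forall>\<beta>\<in>elts \<alpha>. Trans \<beta>)"

definition ord_succ :: "'v::zfc \<Rightarrow> 'v" where
  "ord_succ \<alpha> = vset (insert \<alpha> (elts \<alpha>))"

definition Limit :: "'v::zfc \<Rightarrow> bool" where
  "Limit \<alpha> \<longleftrightarrow> Ord \<alpha> \<and> elts \<alpha> \<noteq> {} \<and> (\<forall>\<xi>\<in>elts \<alpha>. ord_succ \<xi> \<in> elts \<alpha>)"

definition ord_sup :: "'v::zfc set \<Rightarrow> 'v" where
  "ord_sup X = vset (\<Union>\<xi>\<in>X. elts \<xi>)"

definition ord_least :: "('v::zfc \<Rightarrow> bool) \<Rightarrow> 'v" where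
  "ord_least P = (THE \<alpha>. Ord \<alpha> \<and> P \<alpha> \<and> (\<forall>\<beta>. Ord \<beta> \<and> P \<beta> \<longrightarrow> elts \<alpha> \<subseteq> elts \<beta>))"

definition omega :: "'v::zfc" where
  "omega = ord_least (\<lambda>\<alpha>. infinite (elts \<alpha>))"

definition omega1 :: "'v::zfc" where
  "omega1 = ord_least (\<lambda>\<alpha>. uncountable (elts \<alpha>))"

definition cof :: "'v::zfc \<Rightarrow> 'v" where
  "cof \<alpha> = ord_least (\<lambda>\<beta>. \<exists>f. (\<forall>\<eta>\<in>elts \<beta>. f \<eta> \<in> elts \<alpha>) \<and>
                               (\<forall>\<xi>\<in>elts \<alpha>. \<exists>\<eta>\<in>elts \<beta>. elts \<xi> \<subseteq> elts (f \<eta>)))"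

definition regular :: "'v::zfc \<Rightarrow> bool" where
  "regular \<kappa> \<longleftrightarrow> Ord \<kappa> \<and> infinite (elts \<kappa>) \<and> cof \<kappa> = \<kappa>"

definition S_cof :: "'v::zfc \<Rightarrow> 'v \<Rightarrow> 'v set" where
  "S_cof \<kappa> \<mu> = {\<alpha> \<in> elts \<kappa>. cof \<alpha> = \<mu>}"


section \<open>Clubs and stationary sets\<close>

text \<open>Strict inequality makes this false for successor ordinals \<open>\<gamma>\<close>, so that a nonzero \<open>\<gamma>\<close>
  satisfying it is a limit point of \<open>A\<close>.\<close>

definition unbounded_in :: "'v::zfc \<Rightarrow> 'v set \<Rightarrow> bool" where
  "unbounded_in \<gamma> A \<longleftrightarrow> (\<forall>\<xi>\<in>elts \<gamma>. \<exists>\<eta>\<in>A \<inter> elts \<gamma>. \<xi> \<in> elts \<eta>)"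

definition club_in :: "'v::zfc \<Rightarrow> 'v set \<Rightarrow> bool" where
  "club_in \<gamma> C \<longleftrightarrow> C \<subseteq> elts \<gamma> \<and> unbounded_in \<gamma> C \<and>
     (\<forall>\<delta>\<in>elts \<gamma>. elts \<delta> \<noteq> {} \<and> unbounded_in \<delta> C \<longrightarrow> \<delta> \<in> C)"

definition stationary_in :: "'v::zfc \<Rightarrow> 'v set \<Rightarrow> bool" where
  "stationary_in \<gamma> S \<longleftrightarrow> S \<subseteq> elts \<gamma> \<and> (\<forall>C. club_in \<gamma> C \<longrightarrow> S \<inter> C \<noteq> {})"

text \<open>\<open>[Y]\<^sup>\<omega>\<close> (finite sets included) and \<open>[Y]\<^bsup>\<omega>\<^sub>1\<^esup>\<close>, where \<open>Y\<close> is the extension of a set\<close>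

definition subsets_omega :: "'v::zfc set \<Rightarrow> 'v set" where
  "subsets_omega Y = {x. elts x \<subseteq> Y \<and> countable (elts x)}"

definition subsets_omega1 :: "'v::zfc set \<Rightarrow> 'v set" where
  "subsets_omega1 Y = {x. elts x \<subseteq> Y \<and> elts x \<approx> elts (omega1 :: 'v)}"

text \<open>Clubs in \<open>P = [Y]\<^sup>\<mu>\<close>, for an infinite cardinal \<open>\<mu>\<close>: cofinal in \<open>P\<close>, and closed under unions
  of nonempty increasing sequences of length less than \<open>\<mu>\<^sup>+\<close>\<close>

definition club_subsets :: "'v::zfc \<Rightarrow> 'v set \<Rightarrow> 'v set \<Rightarrow> bool" where
  "club_subsets \<mu> P C \<longleftrightarrow> C \<subseteq> P \<and> (\<forall>x\<in>P. \<exists>y\<in>C. elts x \<subseteq> elts y) \<and>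
     (\<forall>(\<alpha> :: 'v) f. Ord \<alpha> \<and> elts \<alpha> \<noteq> {} \<and> elts \<alpha> \<lesssim> elts \<mu> \<and> (\<forall>\<xi>\<in>elts \<alpha>. f \<xi> \<in> C) \<and>
            (\<forall>\<eta>\<in>elts \<alpha>. \<forall>\<xi>\<in>elts \<eta>. elts (f \<xi>) \<subseteq> elts (f \<eta>))
        \<longrightarrow> vset (\<Union>\<xi>\<in>elts \<alpha>. elts (f \<xi>)) \<in> C)"

definition stationary_subsets :: "'v::zfc \<Rightarrow> 'v set \<Rightarrow> 'v set \<Rightarrow> bool" where
  "stationary_subsets \<mu> P S \<longleftrightarrow> S \<subseteq> P \<and> (\<forall>C. club_subsets \<mu> P C \<longrightarrow> S \<inter> C \<noteq> {})"


section \<open>Reflection principles\<close>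

definition trcl :: "'v::zfc \<Rightarrow> 'v set" where
  "trcl x = {y. (y, x) \<in> {(u, v). u \<in> elts v}\<^sup>+}"

definition H :: "'v::zfc \<Rightarrow> 'v set" where
  "H \<kappa> = {x. trcl x \<prec> elts \<kappa>}"

definition lift :: "'v::zfc \<Rightarrow> 'v set \<Rightarrow> 'v set" where
  "lift \<kappa> A = {x \<in> subsets_omega (H \<kappa>). ord_sup (elts x \<inter> elts \<kappa>) \<in> A}"

definition S_lift :: "'v::zfc \<Rightarrow> 'v set" where
  "S_lift \<kappa> = {vset (lift \<kappa> A \<inter> C) | A C.
     A \<subseteq> S_cof \<kappa> omega \<and> stationary_in \<kappa> A \<and> club_subsets omega (subsets_omega (H \<kappa>)) C}"

definition internally_approachable :: "'v::zfc set \<Rightarrow> bool" where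
  "internally_approachable N \<longleftrightarrow>
     (\<exists>f :: 'v \<Rightarrow> 'v.
        N = (\<Union>\<alpha>\<in>elts omega1. elts (f \<alpha>)) \<and>
        (\<forall>\<alpha>\<in>elts omega1. countable (elts (f \<alpha>)) \<and> f \<alpha> \<in> elts (f (ord_succ \<alpha>)) \<and>
           (Limit \<alpha> \<longrightarrow> elts (f \<alpha>) = (\<Union>\<xi>\<in>elts \<alpha>. elts (f \<xi>))) \<and>
           vseq f \<alpha> \<in> N))"

definition wDRP_IA :: "'v::zfc \<Rightarrow> 'v set \<Rightarrow> bool" where
  "wDRP_IA \<kappa> \<S> \<longleftrightarrow>
     (\<forall>\<theta>. regular \<theta> \<and> \<S> \<subseteq> H \<theta> \<longrightarrow>
        stationary_subsets omega1 (subsets_omega1 (H \<theta>))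
          {W \<in> subsets_omega1 (H \<theta>).
             internally_approachable (elts W \<inter> H \<kappa>) \<and>
             (\<forall>S\<in>elts W \<inter> \<S>.
                stationary_subsets omega (subsets_omega (elts W \<inter> H \<kappa>))
                  (elts S \<inter> subsets_omega (elts W \<inter> H \<kappa>)))})"

text \<open>\<open>DSR \<kappa> \<mu> S\<close> is \<open>DSR(\<mu>, S)\<close> for a stationary subset \<open>S\<close> of \<open>\<kappa>\<close>.\<close>

definition DSR :: "'v::zfc \<Rightarrow> 'v \<Rightarrow> 'v set \<Rightarrow> bool" where
  "DSR \<kappa> \<mu> S \<longleftrightarrow>
     (\<forall>j T.
        (\<forall>\<alpha>\<in>elts \<kappa>. Ord (j \<alpha>) \<and> elts (j \<alpha>) \<subseteq> elts \<mu> \<and>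
           (\<forall>i\<in>elts (j \<alpha>). T \<alpha> i \<subseteq> S \<and> stationary_in \<kappa> (T \<alpha> i)))
        \<longrightarrow> (\<exists>\<gamma>\<in>elts \<kappa>. omega \<in> elts (cof \<gamma>) \<and>
              (\<exists>F. club_in \<gamma> F \<and>
                 (\<forall>\<alpha>\<in>F. \<forall>i\<in>elts (j \<alpha>). stationary_in \<gamma> (T \<alpha> i \<inter> elts \<gamma>)))))"

end

theory Submission
  imports Defs
begin

text \<open>
  Let stationary sets \<open>S\<^bsub>\<alpha>,i\<^esub> \<subseteq> S\<^sup>\<kappa>\<^sub>\<omega>\<close> be given. Each lift \<open>{x \<in> [H\<^sub>\<kappa>]\<^sup>\<omega> | sup(x \<inter> \<kappa>) \<in> S\<^bsub>\<alpha>,i\<^esub>}\<close> is one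
  of the sets to which the reflection principle applies. For a large regular \<open>\<theta>\<close>, the sets
  \<open>W \<in> [H\<^sub>\<theta>]\<^bsup>\<omega>\<^sub>1\<^esup>\<close> that contain, with each \<open>\<alpha> \<in> W \<inter> \<kappa>\<close>, its successor and the at most \<open>\<omega>\<^sub>1\<close> many
  lifts with index \<open>\<alpha>\<close>, and with each countable \<open>x \<subseteq> H\<^sub>\<kappa>\<close> in \<open>W\<close> the ordinal \<open>sup(x \<inter> \<kappa>)\<close>, form a club
  (\<open>closure_club_omega1\<close>). The reflection principle provides such a \<open>W\<close> for which
  \<open>X = W \<inter> H\<^sub>\<kappa>\<close> is internally approachable and every lift in \<open>W\<close> is stationary in \<open>[X]\<^sup>\<omega>\<close>. The
  reflection point is \<open>\<gamma> = sup(W \<inter> \<kappa>)\<close>, which is below \<open>\<kappa>\<close> since \<open>|W| = \<omega>\<^sub>1 < \<kappa>\<close>.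

  Two facts give the conclusion. First, if \<open>N\<close> is a chain witnessing that \<open>X\<close> is internally
  approachable, then the ordinals \<open>sup(N\<^sub>\<lambda> \<inter> \<kappa>)\<close> for limit \<open>\<lambda> < \<omega>\<^sub>1\<close> lie in \<open>X\<close>, because \<open>N\<^sub>\<lambda> \<in> X\<close>, and they
  form a club in \<open>\<gamma>\<close>, which moreover has uncountable cofinality
  (\<open>internally_approachable_club\<close>). Second, for a club \<open>D\<close> in \<open>\<gamma>\<close> the set of
  \<open>x \<in> [X]\<^sup>\<omega>\<close> with \<open>sup(x \<inter> \<kappa>) \<in> D\<close> is club in \<open>[X]\<^sup>\<omega>\<close> (\<open>lift_club\<close>); it therefore meets
  the lift of \<open>S\<^bsub>\<alpha>,i\<^esub>\<close> for every \<open>\<alpha> \<in> X \<inter> \<kappa>\<close>, which says that \<open>D\<close> meets \<open>S\<^bsub>\<alpha>,i\<^esub>\<close>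
  (\<open>stationary_in_of_lift\<close>). So \<open>S\<^bsub>\<alpha>,i\<^esub> \<inter> \<gamma>\<close> is stationary for every \<open>\<alpha>\<close> in that club.

  Two existence statements carry the set-theoretic background: \<open>H\<^sub>\<kappa>\<close> is a set (\<open>is_set_H\<close>), so that the
  lifts are sets, and there are large regular cardinals (\<open>ex_regular_H\<close>). Both come from one
  form of the Mostowski collapse.
\<close>

section \<open>Sets and classes\<close>

definition is_set :: "'v::zfc set \<Rightarrow> bool" where
  "is_set X \<longleftrightarrow> (\<exists>x. elts x = X)"

lemma is_set_elts [simp, intro]: "is_set (elts x)"
  unfolding is_set_def by blast

lemma vset_elts [simp]: "vset (elts x) = x"
  unfolding vset_def by (rule the_equality) (auto intro: extensionality)

lemma elts_vset: "is_set X \<Longrightarrow> elts (vset X) = X"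
  unfolding is_set_def by auto

lemma is_set_subset: "is_set Y \<Longrightarrow> X \<subseteq> Y \<Longrightarrow> is_set X"
proof -
  assume "is_set Y" "X \<subseteq> Y"
  then obtain y where y: "elts y = Y" unfolding is_set_def by blast
  obtain z where "elts z = {u \<in> elts y. u \<in> X}" using separation[of y "\<lambda>u. u \<in> X"] by blast
  then have "elts z = X" using y \<open>X \<subseteq> Y\<close> by blast
  then show ?thesis unfolding is_set_def by blast
qed

lemma is_set_Int: "is_set (elts x \<inter> Y)"
  by (rule is_set_subset[OF is_set_elts[of x]]) blast

lemma is_set_image: "is_set X \<Longrightarrow> is_set ((f :: 'v::zfc \<Rightarrow> 'v) ` X)"
  unfolding is_set_def using replacement[of f] by blast

lemma is_set_lepoll: "(X :: 'v::zfc set) \<lesssim> elts (y::'v) \<Longrightarrow> is_set X"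
  by (meson is_set_elts is_set_image is_set_subset lepoll_iff)

lemma is_set_UN:
  fixes A :: "'v::zfc \<Rightarrow> 'v set"
  assumes "is_set I" "\<And>i. i \<in> I \<Longrightarrow> is_set (A i)"
  shows "is_set (\<Union>i\<in>I. A i)"
proof -
  obtain s where s: "elts s = (\<lambda>i. vset (A i)) ` I"
    using is_set_image[OF assms(1), of "\<lambda>i. vset (A i)"] unfolding is_set_def by blast
  obtain u where "elts u = (\<Union>z\<in>elts s. elts z)" using union by blast
  then have "elts u = (\<Union>i\<in>I. A i)" using s assms(2) by (auto simp: elts_vset)
  then show ?thesis unfolding is_set_def by blast
qed

lemma is_set_Pow: "is_set X \<Longrightarrow> is_set {z. elts z \<subseteq> X}"
  unfolding is_set_def using powerset by blast

lemma is_set_Un: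
  assumes "is_set (X::'v::zfc set)" "is_set Y" shows "is_set (X \<union> Y)"
proof -
  obtain z where z: "elts z = {vset X, vset Y}" using pairing by blast
  have "is_set (\<Union>u\<in>elts z. elts u)" by (rule is_set_UN) auto
  then show ?thesis using z assms by (simp add: elts_vset)
qed

lemma is_set_insert: "is_set (X :: 'v::zfc set) \<Longrightarrow> is_set (insert x X)"
proof -
  assume X: "is_set X"
  obtain z where z: "elts z = {x, x}" using pairing by blast
  then have "is_set {x}" unfolding is_set_def by auto
  from is_set_Un[OF this X] show ?thesis by simp
qed

lemma elts_vset_UN:
  fixes f :: "'v::zfc \<Rightarrow> 'v"
  shows "elts (vset (\<Union>\<xi>\<in>elts a. elts (f \<xi>))) = (\<Union>\<xi>\<in>elts a. elts (f \<xi>))"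
  by (intro elts_vset is_set_UN is_set_elts)

abbreviation mem_rel :: "('v::zfc \<times> 'v) set" where
  "mem_rel \<equiv> {(x, y). x \<in> elts y}"

lemma mem_irrefl: "x \<notin> elts (x::'v::zfc)"
  using wf_irrefl[OF foundation, of x] by simp

section \<open>Infinite cardinalities\<close>

lemma lepoll_iff_ordLeq: "A \<lesssim> B \<longleftrightarrow> (card_of A, card_of B) \<in> ordLeq"
  unfolding lepoll_def card_of_ordLeq[symmetric] ..

lemma lepoll_total: "A \<lesssim> B \<or> B \<lesssim> A"
  unfolding lepoll_iff_ordLeq by (rule ordLeq_total) (auto simp: card_of_Well_order)

lemma UN_lepoll_infinite:
  assumes "infinite K" "I \<lesssim> K" "\<And>i. i \<in> I \<Longrightarrow> A i \<lesssim> K"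
  shows "(\<Union>i\<in>I. A i) \<lesssim> K"
  using card_of_UNION_ordLeq_infinite assms unfolding lepoll_iff_ordLeq by blast

lemma Un_lepoll_infinite:
  assumes "infinite K" "A \<lesssim> K" "B \<lesssim> K" shows "A \<union> B \<lesssim> K"
proof -
  have "(UNIV::bool set) \<lesssim> K" using assms(1) by (simp add: finite_lepoll_infinite)
  then have "(\<Union>b\<in>UNIV. if b then A else B) \<lesssim> K"
    using assms by (intro UN_lepoll_infinite) auto
  moreover have "(\<Union>b\<in>UNIV. if b then A else B) = A \<union> B" by auto
  ultimately show ?thesis by simp
qed

lemma countable_lepoll_infinite: "countable A \<Longrightarrow> infinite K \<Longrightarrow> A \<lesssim> K"
  by (metis countableE infinite_le_lepoll lepoll_def lepoll_trans subset_UNIV)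

section \<open>Ordinals\<close>

lemma OrdD: "Ord a \<Longrightarrow> x \<in> elts a \<Longrightarrow> y \<in> elts x \<Longrightarrow> y \<in> elts a"
  unfolding Ord_def Trans_def by blast

lemma Ord_mem: "Ord a \<Longrightarrow> x \<in> elts a \<Longrightarrow> Ord x"
  unfolding Ord_def Trans_def by blast

lemma OrdI:
  "(\<And>x y. x \<in> elts a \<Longrightarrow> y \<in> elts x \<Longrightarrow> y \<in> elts a) \<Longrightarrow> (\<And>x. x \<in> elts a \<Longrightarrow> Ord x) \<Longrightarrow> Ord a"
  unfolding Ord_def Trans_def by blast

text \<open>
  Two incomparable ordinals would differ by an element of one of them; nested induction on both
  ordinals makes this element comparable with the other ordinal, and transitivity finishes.
\<close>
lemma Ord_linear: "Ord (a::'v::zfc) \<Longrightarrow> Ord b \<Longrightarrow> a \<in> elts b \<or> a = b \<or> b \<in> elts a"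
proof (induction a arbitrary: b rule: wf_induct_rule[OF foundation])
  case (1 a)
  note outer = 1
  from 1(3) show ?case
  proof (induction b rule: wf_induct_rule[OF foundation])
    case (1 b)
    show ?case
    proof (cases "a = b")
      case False
      then consider x where "x \<in> elts a" "x \<notin> elts b" | y where "y \<in> elts b" "y \<notin> elts a"
        using extensionality by blast
      then show ?thesis
      proof cases
        case (1 x)
        then have "x \<in> elts b \<or> x = b \<or> b \<in> elts x"
          using outer(1)[of x b] Ord_mem[OF outer(2)] \<open>Ord b\<close> by simp
        then show ?thesis using 1 OrdD[OF outer(2)] by blast
      next
        case (2 y)
        then have "a \<in> elts y \<or> a = y \<or> y \<in> elts a"
          using "1.IH"[of y] Ord_mem[OF \<open>Ord b\<close>] by simp
        then show ?thesis using 2 OrdD[OF \<open>Ord b\<close>] by blast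
      qed
    qed simp
  qed
qed

lemma mem_asym: "x \<in> elts y \<Longrightarrow> y \<notin> elts (x::'v::zfc)"
  using wf_asym[OF foundation, of x y] by simp

lemma Ord_mem_iff_not_subset: "Ord a \<Longrightarrow> Ord b \<Longrightarrow> a \<in> elts b \<longleftrightarrow> \<not> elts b \<subseteq> elts a"
  using Ord_linear[of a b] OrdD mem_asym mem_irrefl by blast

lemma Ord_psubset_mem: "Ord a \<Longrightarrow> Ord b \<Longrightarrow> elts a \<subseteq> elts b \<Longrightarrow> a \<noteq> b \<Longrightarrow> a \<in> elts b"
  using Ord_linear[of a b] mem_irrefl by blast

lemma Ord_subset_mem: "Ord a \<Longrightarrow> elts c \<subseteq> elts b \<Longrightarrow> Ord b \<Longrightarrow> Ord c \<Longrightarrow> b \<in> elts a \<Longrightarrow> c \<in> elts a"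
  by (meson Ord_mem_iff_not_subset subset_trans)

lemma elts_ord_succ: "elts (ord_succ a) = insert a (elts a)"
  unfolding ord_succ_def by (simp add: elts_vset is_set_insert)

lemma Ord_ord_succ: "Ord a \<Longrightarrow> Ord (ord_succ a)"
  by (rule OrdI) (auto simp: elts_ord_succ dest: OrdD Ord_mem)

lemma elts_ord_sup: "is_set X \<Longrightarrow> elts (ord_sup X) = (\<Union>x\<in>X. elts x)"
  unfolding ord_sup_def by (intro elts_vset is_set_UN is_set_elts)

lemma Ord_ord_sup: "is_set X \<Longrightarrow> (\<And>x. x \<in> X \<Longrightarrow> Ord x) \<Longrightarrow> Ord (ord_sup X)"
  by (rule OrdI) (auto simp: elts_ord_sup dest: OrdD Ord_mem)

lemma Ord_vset: "is_set X \<Longrightarrow> (\<And>x. x \<in> X \<Longrightarrow> elts x \<subseteq> X) \<Longrightarrow> (\<And>x. x \<in> X \<Longrightarrow> Ord x) \<Longrightarrow> Ord (vset X)"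
  by (rule OrdI) (auto simp: elts_vset)

lemma ord_least:
  assumes "Ord (a::'v::zfc)" "P a"
  shows "Ord (ord_least P)" "P (ord_least P)"
    "\<And>b. Ord b \<Longrightarrow> P b \<Longrightarrow> elts (ord_least P) \<subseteq> elts b"
proof -
  obtain m where m: "Ord m" "P m" "\<And>y. y \<in> elts m \<Longrightarrow> \<not> (Ord y \<and> P y)"
    using wfE_min[OF foundation, of a "{x. Ord x \<and> P x}"] assms by auto
  have least: "elts m \<subseteq> elts b" if "Ord b" "P b" for b
    using m that Ord_mem_iff_not_subset by blast
  have "ord_least P = m"
    unfolding ord_least_def
  proof (rule the_equality)
    show "Ord m \<and> P m \<and> (\<forall>\<beta>. Ord \<beta> \<and> P \<beta> \<longrightarrow> elts m \<subseteq> elts \<beta>)" using m least by blast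
    fix a assume "Ord a \<and> P a \<and> (\<forall>\<beta>. Ord \<beta> \<and> P \<beta> \<longrightarrow> elts a \<subseteq> elts \<beta>)"
    then have "elts a = elts m" using least m by (meson subset_antisym)
    then show "a = m" by (rule extensionality)
  qed
  then show "Ord (ord_least P)" "P (ord_least P)"
    "\<And>b. Ord b \<Longrightarrow> P b \<Longrightarrow> elts (ord_least P) \<subseteq> elts b"
    using m least by auto
qed

section \<open>Collapsing\<close>

text \<open>
  The Mostowski collapse. For the transitive closure of \<open>\<in>\<close> it is the rank of a set, and for a
  well-order of a set it is the enumeration of that set by an ordinal.
\<close>
definition collapse :: "('v::zfc \<times> 'v) set \<Rightarrow> 'v \<Rightarrow> 'v" where
  "collapse R = wfrec R (\<lambda>c d. vset (c ` {e. (e, d) \<in> R}))"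

lemma elts_collapse:
  assumes "wf R" "is_set {e. (e, d) \<in> R}"
  shows "elts (collapse R d) = collapse R ` {e. (e, d) \<in> R}"
proof -
  have "collapse R d = vset (cut (collapse R) R d ` {e. (e, d) \<in> R})"
    unfolding collapse_def by (subst wfrec[OF assms(1)]) simp
  also have "cut (collapse R) R d ` {e. (e, d) \<in> R} = collapse R ` {e. (e, d) \<in> R}"
    by (auto simp: cut_def image_def)
  finally show ?thesis using assms(2) by (simp add: elts_vset is_set_image)
qed

lemma Ord_collapse:
  assumes "wf R" "trans R" "\<And>d. is_set {e. (e, d) \<in> R}"
  shows "Ord (collapse R d)"
  using assms(1)
proof (induction d rule: wf_induct_rule)
  case (less d)
  show ?case
    by (rule OrdI) (auto simp: elts_collapse[OF assms(1,3)] less intro!: imageI intro: transD[OF assms(2)])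
qed

text \<open>
  A well-order of \<open>x\<close> is collapsed injectively, because comparable elements have values one of which
  is an element of the other, and the set of the values is transitive.
\<close>
lemma ex_Ord_eqpoll: "\<exists>a::'v. Ord a \<and> elts a \<approx> elts (x::'v::zfc)"
proof -
  obtain r where r: "well_order_on (elts x) r" using well_order_on by blast
  have field: "r \<subseteq> elts x \<times> elts x"
    using r unfolding well_order_on_def linear_order_on_def partial_order_on_def preorder_on_def
      by (metis refl_on_def)
  define R where "R = r - Id"
  have "wf R" using r unfolding R_def well_order_on_def by blast
  have "trans R"
    using r unfolding R_def well_order_on_def linear_order_on_def partial_order_on_def preorder_on_def
    by (meson trans_diff_Id)
  have sets: "is_set {e. (e, d) \<in> R}" for d
    by (rule is_set_subset[OF is_set_elts[of x]]) (use field R_def in blast)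
  let ?c = "collapse R"
  have "inj_on ?c (elts x)"
  proof (rule inj_onI, rule ccontr)
    fix d e assume de: "d \<in> elts x" "e \<in> elts x" "?c d = ?c e" "d \<noteq> e"
    then have "(d, e) \<in> R \<or> (e, d) \<in> R"
      using r unfolding R_def well_order_on_def linear_order_on_def total_on_def by blast
    then show False using de(3) elts_collapse[OF \<open>wf R\<close> sets] mem_irrefl by (metis imageI mem_Collect_eq)
  qed
  then have "?c ` elts x \<approx> elts x" by (simp add: inj_on_image_eqpoll_self)
  moreover have "Ord (vset (?c ` elts x))"
  proof (rule Ord_vset)
    show "is_set (?c ` elts x)" by (simp add: is_set_image)
    fix y assume "y \<in> ?c ` elts x"
    then obtain d where d: "d \<in> elts x" "y = ?c d" by blast
    have "{e. (e, d) \<in> R} \<subseteq> elts x" using field R_def by blast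
    then show "elts y \<subseteq> ?c ` elts x" using d elts_collapse[OF \<open>wf R\<close> sets, of d] by auto
    show "Ord y" using d Ord_collapse[OF \<open>wf R\<close> \<open>trans R\<close> sets] by simp
  qed
  moreover have "elts (vset (?c ` elts x)) = ?c ` elts x" by (simp add: elts_vset is_set_image)
  ultimately show ?thesis by metis
qed

text \<open>
  Enumerate the power set; by Cantor's theorem the resulting ordinal is too large.
\<close>
lemma ex_Ord_not_lepoll: "\<exists>a::'v. Ord a \<and> \<not> elts a \<lesssim> elts (x::'v::zfc)"
proof -
  obtain p where p: "elts p = {z. elts z \<subseteq> elts x}" using powerset by blast
  obtain a :: 'v where a: "Ord a" "elts a \<approx> elts p" using ex_Ord_eqpoll by blast
  have "Pow (elts x) \<subseteq> elts ` elts p"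
  proof
    fix Y assume "Y \<in> Pow (elts x)"
    then have "elts (vset Y) = Y" by (intro elts_vset is_set_subset[OF is_set_elts]) auto
    then show "Y \<in> elts ` elts p" using p \<open>Y \<in> Pow (elts x)\<close> by (metis PowD imageI mem_Collect_eq)
  qed
  then have "Pow (elts x) \<lesssim> elts p" by (simp add: subset_image_lepoll)
  then have "\<not> elts a \<lesssim> elts x"
    using a(2) lesspoll_Pow_self[of "elts x"]
    by (metis eqpoll_sym lepoll_trans lepoll_trans1 lesspoll_not_refl lesspoll_trans2 )
  then show ?thesis using a by blast
qed

section \<open>\<open>\<omega>\<close> and \<open>\<omega>\<^sub>1\<close>\<close>

lemma ex_countable_infinite_Ord: "\<exists>a::'v::zfc. Ord a \<and> infinite (elts a) \<and> countable (elts a)"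
proof -
  obtain I :: 'v where I: "\<exists>e\<in>elts I. elts e = {}"
      "\<forall>y\<in>elts I. \<exists>s\<in>elts I. elts s = insert y (elts y)"
    using infinity by blast
  obtain z where z: "z \<in> elts I" "elts z = {}" using I by blast
  define f where "f n = (ord_succ ^^ n) z" for n
  have Suc: "elts (f (Suc n)) = insert (f n) (elts (f n))" for n
    by (simp add: f_def elts_ord_succ)
  have f0: "elts (f 0) = {}" by (simp add: f_def z)
  have fI: "f n \<in> elts I" for n
  proof (induction n)
    case 0 then show ?case using z by (simp add: f_def)
  next
    case (Suc n)
    then obtain s where "s \<in> elts I" "elts s = insert (f n) (elts (f n))" using I by blast
    then show ?case using \<open>elts (f (Suc n)) = insert (f n) (elts (f n))\<close> extensionality by metis
  qed
  have ef: "elts (f n) = f ` {..<n}" for n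
    by (induction n) (auto simp: f0 Suc lessThan_Suc)
  have Of: "Ord (f n)" for n
  proof (induction n)
    case 0 show ?case by (rule OrdI) (auto simp: f0)
  next
    case (Suc n) then show ?case by (simp add: f_def Ord_ord_succ)
  qed
  have "f m \<noteq> f n" if "m < n" for m n
    using ef[of n] that mem_irrefl by (metis imageI lessThan_iff)
  then have "inj f" by (metis injI linorder_neqE_nat)
  have s: "is_set (range f)" by (rule is_set_subset[OF is_set_elts[of I]]) (use fI in blast)
  have "Ord (vset (range f))" by (rule Ord_vset[OF s]) (auto simp: Of ef)
  then show ?thesis using \<open>inj f\<close> s
    by (intro exI[of _ "vset (range f)"]) (auto simp: elts_vset range_inj_infinite)
qed

lemma omega: "Ord (omega::'v::zfc)" "infinite (elts (omega::'v))" "countable (elts (omega::'v))"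
proof -
  obtain a :: 'v where a: "Ord a" "infinite (elts a)" "countable (elts a)"
    using ex_countable_infinite_Ord by blast
  note l = ord_least[of a "\<lambda>a. infinite (elts a)", OF a(1,2), folded omega_def]
  show "Ord (omega::'v)" "infinite (elts (omega::'v))" using l by auto
  show "countable (elts (omega::'v))" using l(3)[OF a(1,2)] a(3) countable_subset by blast
qed

lemma countable_iff_lepoll_omega: "countable A \<longleftrightarrow> A \<lesssim> elts (omega::'v::zfc)"
  using countable_lepoll_infinite countable_lepoll omega(2,3) by metis

text \<open>
  The third fact is the description of \<open>\<omega>\<^sub>1\<close> used below: it consists of the countable ordinals.
\<close>
lemma omega1:
  "Ord (omega1::'v::zfc)" "uncountable (elts (omega1::'v))"
  "\<And>a. Ord (a::'v) \<Longrightarrow> a \<in> elts omega1 \<longleftrightarrow> countable (elts a)"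
proof -
  obtain a :: 'v where a: "Ord a" "\<not> elts a \<lesssim> elts (omega::'v)"
    using ex_Ord_not_lepoll by blast
  then have u: "uncountable (elts a)" using countable_iff_lepoll_omega by metis
  note l = ord_least[of a "\<lambda>a. uncountable (elts a)", OF a(1) u, folded omega1_def]
  show o: "Ord (omega1::'v)" "uncountable (elts (omega1::'v))" using l by auto
  show "a \<in> elts omega1 \<longleftrightarrow> countable (elts a)" if "Ord a" for a :: 'v
  proof
    assume "a \<in> elts omega1"
    then show "countable (elts a)" using l(3)[of a] that Ord_mem_iff_not_subset[OF that o(1)] by blast
  next
    assume "countable (elts a)"
    then show "a \<in> elts omega1" using Ord_mem_iff_not_subset[OF that o(1)] o(2) countable_subset by blast
  qed
qed

lemma infinite_omega1: "infinite (elts (omega1::'v::zfc))"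
  using omega1(2) by (auto dest: countable_finite)

text \<open>
  The witness is \<open>a + \<omega>\<close>, the union of the finite iterated successors of \<open>a\<close>.
\<close>
lemma Limit_above_in_omega1:
  assumes "a \<in> elts (omega1::'v::zfc)"
  shows "\<exists>l\<in>elts omega1. Limit l \<and> a \<in> elts l"
proof -
  define f where "f n = (ord_succ ^^ n) a" for n
  have a: "Ord a" "countable (elts a)" using assms omega1(1,3) Ord_mem by metis+
  have f: "Ord (f n) \<and> countable (elts (f n))" for n
    by (induction n) (auto simp: f_def Ord_ord_succ elts_ord_succ a)
  let ?X = "\<Union>n. elts (f n)"
  have "countable ?X" using f by auto
  then have s: "is_set ?X" by (metis is_set_lepoll countable_iff_lepoll_omega)
  have O: "Ord (vset ?X)" using f by (intro Ord_vset[OF s]) (auto dest: OrdD Ord_mem)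
  have Suc: "f (Suc n) = ord_succ (f n)" for n by (simp add: f_def)
  have "a \<in> elts (f 1)" by (simp add: f_def elts_ord_succ)
  have "ord_succ x \<in> elts (f (Suc n))" if "x \<in> elts (f n)" for x n
  proof -
    have O: "Ord (f n)" "Ord (f (Suc n))" "Ord x" using f Ord_mem that by metis+
    have sub: "elts (ord_succ x) \<subseteq> elts (f n)"
      using that O(1) by (auto simp: elts_ord_succ dest: OrdD)
    show ?thesis
      by (rule Ord_subset_mem[OF O(2) sub O(1) Ord_ord_succ[OF O(3)]]) (simp add: Suc elts_ord_succ)
  qed
  then have "Limit (vset ?X)" unfolding Limit_def using O \<open>a \<in> elts (f 1)\<close>
    by (auto simp: elts_vset[OF s])
  moreover have "vset ?X \<in> elts omega1" using O \<open>countable ?X\<close> omega1(3) by (metis elts_vset s)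
  moreover have "a \<in> elts (vset ?X)" using \<open>a \<in> elts (f 1)\<close> by (auto simp: elts_vset[OF s])
  ultimately show ?thesis by blast
qed

section \<open>Cofinality\<close>

lemma cof_properties:
  assumes "Ord (a::'v::zfc)"
  shows Ord_cof: "Ord (cof a)"
    and ex_cofinal: "\<exists>f. (\<forall>\<eta>\<in>elts (cof a). f \<eta> \<in> elts a) \<and>
                          (\<forall>\<xi>\<in>elts a. \<exists>\<eta>\<in>elts (cof a). elts \<xi> \<subseteq> elts (f \<eta>))"
    and cof_le: "\<And>b f. Ord b \<Longrightarrow> \<forall>\<eta>\<in>elts b. f \<eta> \<in> elts a \<Longrightarrow>
      \<forall>\<xi>\<in>elts a. \<exists>\<eta>\<in>elts b. elts \<xi> \<subseteq> elts (f \<eta>) \<Longrightarrow> elts (cof a) \<subseteq> elts b"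
proof -
  let ?P = "\<lambda>b. \<exists>f. (\<forall>\<eta>\<in>elts b. f \<eta> \<in> elts a) \<and> (\<forall>\<xi>\<in>elts a. \<exists>\<eta>\<in>elts b. elts \<xi> \<subseteq> elts (f \<eta>))"
  have P: "?P a" by (rule exI[of _ "\<lambda>x. x"]) auto
  note l = ord_least[of a ?P, OF assms P, folded cof_def]
  show "Ord (cof a)" by (rule l)
  show "?P (cof a)" by (rule l)
  show "elts (cof a) \<subseteq> elts b" if "Ord b" "\<forall>\<eta>\<in>elts b. f \<eta> \<in> elts a"
      "\<forall>\<xi>\<in>elts a. \<exists>\<eta>\<in>elts b. elts \<xi> \<subseteq> elts (f \<eta>)" for b f
    by (rule l(3)[OF that(1)]) (rule exI[of _ f], use that in simp)
qed

text \<open>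
  An unbounded \<open>X\<close>, listed by \<open>m\<close>, would be a cofinal function from \<open>m < cf(a)\<close>.
\<close>
lemma ord_sup_mem:
  assumes "Ord (a::'v::zfc)" "m \<in> elts (cof a)" "X \<subseteq> elts a" "X \<lesssim> elts m"
  shows "ord_sup X \<in> elts a"
proof (rule ccontr)
  assume n: "ord_sup X \<notin> elts a"
  have s: "is_set X" using assms(4) by (rule is_set_lepoll)
  have O: "Ord (ord_sup X)" using Ord_ord_sup[OF s] assms(1,3) Ord_mem by blast
  have Om: "Ord m" using Ord_cof[OF assms(1)] assms(2) Ord_mem by blast
  have sub: "elts a \<subseteq> elts (ord_sup X)" using n Ord_mem_iff_not_subset[OF O assms(1)] by blast
  have ne: "elts a \<noteq> {}"
  proof
    assume "elts a = {}"
    then have "elts (cof a) \<subseteq> elts a" using cof_le[OF assms(1) assms(1), of "\<lambda>x. x"] by auto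
    then show False using \<open>elts a = {}\<close> assms(2) by auto
  qed
  obtain g where g: "X \<subseteq> g ` elts m" using assms(4) unfolding lepoll_iff by blast
  obtain z where z: "z \<in> elts a" using ne by blast
  define f where "f \<eta> = (if g \<eta> \<in> elts a then g \<eta> else z)" for \<eta>
  have "elts (cof a) \<subseteq> elts m"
  proof (rule cof_le[OF assms(1) Om, of f]; intro ballI)
    show "f \<eta> \<in> elts a" for \<eta> using z by (simp add: f_def)
    fix \<xi> assume "\<xi> \<in> elts a"
    then obtain x where x: "x \<in> X" "\<xi> \<in> elts x" using sub by (auto simp: elts_ord_sup[OF s])
    then obtain \<eta> where "\<eta> \<in> elts m" "x = g \<eta>" using g by blast
    moreover have "Ord x" using x assms(1,3) Ord_mem by blast
    then have "elts \<xi> \<subseteq> elts x" using x OrdD by blast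
    ultimately show "\<exists>\<eta>\<in>elts m. elts \<xi> \<subseteq> elts (f \<eta>)" using x assms(3) by (auto simp: f_def)
  qed
  then show False using assms(2) mem_irrefl by blast
qed

lemma ord_sup_countable_mem:
  assumes "Ord (a::'v::zfc)" "omega \<in> elts (cof a)" "X \<subseteq> elts a" "countable X"
  shows "ord_sup X \<in> elts a"
  using ord_sup_mem[OF assms(1,2,3)] assms(4) by (metis countable_iff_lepoll_omega)

text \<open>
  Regular ordinals are cardinals: a listing of \<open>\<kappa>\<close> by some \<open>b < \<kappa> = cf(\<kappa>)\<close> would bound \<open>\<kappa>\<close> by one
  of its elements.
\<close>
lemma regular_not_lepoll:
  assumes "regular (\<kappa>::'v::zfc)" "b \<in> elts \<kappa>" shows "\<not> elts \<kappa> \<lesssim> elts b"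
proof
  assume "elts \<kappa> \<lesssim> elts b"
  moreover have "Ord \<kappa>" "b \<in> elts (cof \<kappa>)" using assms unfolding regular_def by auto
  ultimately have 1: "ord_sup (elts \<kappa>) \<in> elts \<kappa>" using ord_sup_mem[of \<kappa> b "elts \<kappa>"] by auto
  \<comment> \<open>The supremum is then the greatest element of \<open>\<kappa>\<close>, so a function on the one-element ordinal
     is cofinal, while \<open>cf(\<kappa>)\<close> is infinite.\<close>
  let ?s = "ord_sup (elts \<kappa>)"
  have "elts ?s = (\<Union>x\<in>elts \<kappa>. elts x)" by (rule elts_ord_sup) simp
  then have sub: "elts x \<subseteq> elts ?s" if "x \<in> elts \<kappa>" for x using that by blast
  obtain z where z: "z \<in> elts \<kappa>" "elts z = {}" using 1 wfE_min[OF foundation, of ?s "elts \<kappa>"] \<open>Ord \<kappa>\<close> OrdD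
    by (metis (no_types, lifting) case_prodI ex_in_conv mem_Collect_eq)
  have Oz: "Ord z" using Ord_mem[OF \<open>Ord \<kappa>\<close> z(1)] .
  have "elts (cof \<kappa>) \<subseteq> elts (ord_succ z)"
    by (rule cof_le[OF \<open>Ord \<kappa>\<close> Ord_ord_succ[OF Oz], of "\<lambda>_. ?s"]) (use 1 sub in \<open>auto simp: elts_ord_succ\<close>)
  then have "finite (elts \<kappa>)" using assms(1) z(2) unfolding regular_def by (auto simp: elts_ord_succ intro: finite_subset)
  then show False using assms(1) unfolding regular_def by simp
qed

lemma regular_ord_succ:
  assumes "regular \<kappa>" "\<alpha> \<in> elts \<kappa>" shows "ord_succ \<alpha> \<in> elts \<kappa>"
proof (rule ccontr)
  assume n: "ord_succ \<alpha> \<notin> elts \<kappa>"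
  have O: "Ord \<kappa>" "infinite (elts \<kappa>)" using assms(1) by (auto simp: regular_def)
  have "elts \<kappa> \<subseteq> elts (ord_succ \<alpha>)"
    using Ord_mem_iff_not_subset[OF Ord_ord_succ[OF Ord_mem[OF O(1) assms(2)]] O(1)] n by blast
  then have sub: "elts \<kappa> \<subseteq> insert \<alpha> (elts \<alpha>)" by (simp add: elts_ord_succ)
  then have "infinite (elts \<alpha>)" using O(2) by (metis finite_insert finite_subset)
  then have "elts \<kappa> \<lesssim> elts \<alpha>"
    using lepoll_trans[OF subset_imp_lepoll[OF sub] infinite_insert_lepoll] by simp
  then show False using regular_not_lepoll[OF assms] by blast
qed

text \<open>
  The least ordinal that does not inject into \<open>d\<close> is the successor cardinal of \<open>|d|\<close>. It is regular
  since a union of at most \<open>|d|\<close> many sets of size at most \<open>|d|\<close> has size at most \<open>|d|\<close>.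
\<close>
lemma regular_least_not_lepoll:
  assumes "infinite (elts (d::'v::zfc))"
  shows "regular (ord_least (\<lambda>a::'v. \<not> elts a \<lesssim> elts d))" (is "regular ?t")
    and "\<not> elts (ord_least (\<lambda>a::'v. \<not> elts a \<lesssim> elts d)) \<lesssim> elts d"
proof -
  obtain a :: 'v where a: "Ord a" "\<not> elts a \<lesssim> elts d" using ex_Ord_not_lepoll by blast
  note l = ord_least[of a "\<lambda>a::'v. \<not> elts a \<lesssim> elts d", OF a]
  show nl: "\<not> elts ?t \<lesssim> elts d" by (rule l)
  have O: "Ord ?t" by (rule l)
  have below: "elts b \<lesssim> elts d" if "b \<in> elts ?t" for b
    using l(3)[of b] Ord_mem[OF O that] that mem_irrefl by blast
  have "cof ?t = ?t"
  proof (rule ccontr)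
    assume ne: "cof ?t \<noteq> ?t"
    have "elts (cof ?t) \<subseteq> elts ?t" by (rule cof_le[OF O O, of "\<lambda>x. x"]) auto
    then have "cof ?t \<in> elts ?t" using Ord_linear[OF Ord_cof[OF O] O] ne mem_irrefl by blast
    obtain f where f: "\<forall>\<eta>\<in>elts (cof ?t). f \<eta> \<in> elts ?t"
        "\<forall>\<xi>\<in>elts ?t. \<exists>\<eta>\<in>elts (cof ?t). elts \<xi> \<subseteq> elts (f \<eta>)"
      using ex_cofinal[OF O] by blast
    have "elts ?t \<lesssim> (\<Union>\<eta>\<in>elts (cof ?t). elts (ord_succ (f \<eta>)))"
    proof (rule subset_imp_lepoll, rule subsetI)
      fix \<xi> assume x: "\<xi> \<in> elts ?t"
      then obtain \<eta> where e: "\<eta> \<in> elts (cof ?t)" "elts \<xi> \<subseteq> elts (f \<eta>)" using f by blast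
      have "\<xi> = f \<eta> \<or> \<xi> \<in> elts (f \<eta>)"
        using Ord_linear[of \<xi> "f \<eta>"] Ord_mem[OF O] x e f mem_irrefl by blast
      then show "\<xi> \<in> (\<Union>\<eta>\<in>elts (cof ?t). elts (ord_succ (f \<eta>)))" using e by (auto simp: elts_ord_succ)
    qed
    also have "\<dots> \<lesssim> elts d"
    proof (rule UN_lepoll_infinite[OF assms below[OF \<open>cof ?t \<in> elts ?t\<close>]])
      fix \<eta> assume "\<eta> \<in> elts (cof ?t)"
      then have "elts (f \<eta>) \<lesssim> elts d" using f below by blast
      moreover have "{f \<eta>} \<lesssim> elts d" using assms by (simp add: finite_lepoll_infinite)
      ultimately show "elts (ord_succ (f \<eta>)) \<lesssim> elts d"
        using Un_lepoll_infinite[OF assms] by (metis elts_ord_succ insert_is_Un)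
    qed
    finally show False using nl by blast
  qed
  moreover have "infinite (elts ?t)" using nl finite_lepoll_infinite[OF assms] by blast
  ultimately show "regular ?t" using O unfolding regular_def by blast
qed

section \<open>The sets \<open>H \<kappa>\<close>\<close>

lemma trcl_eq: "trcl x = {y. (y, x) \<in> mem_rel\<^sup>+}"
  by (simp add: trcl_def)

lemma trcl_trans: "y \<in> trcl x \<Longrightarrow> trcl y \<subseteq> trcl x"
  unfolding trcl_eq by (auto intro: trancl_trans)

lemma mem_trcl: "y \<in> elts x \<Longrightarrow> y \<in> trcl x"
  unfolding trcl_eq by blast

lemma trcl_UN: "trcl x = (\<Union>y\<in>elts x. insert y (trcl y))"
proof
  show "trcl x \<subseteq> (\<Union>y\<in>elts x. insert y (trcl y))"
    unfolding trcl_eq by (auto elim: tranclE)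
  show "(\<Union>y\<in>elts x. insert y (trcl y)) \<subseteq> trcl x"
    using mem_trcl trcl_trans by blast
qed

lemma is_set_trcl: "is_set (trcl (x::'v::zfc))"
proof (induction x rule: wf_induct_rule[OF foundation])
  case (1 x)
  then show ?case by (subst trcl_UN) (intro is_set_UN is_set_insert is_set_elts, simp)
qed

lemma trcl_Ord: "Ord a \<Longrightarrow> trcl a = elts a"
proof (induction a rule: wf_induct_rule[OF foundation])
  case (1 a)
  then have "trcl y = elts y" if "y \<in> elts a" for y using that Ord_mem by blast
  then have "trcl a = (\<Union>y\<in>elts a. insert y (elts y))" using trcl_UN[of a] by simp
  then show ?case using 1(2) OrdD by blast
qed

text \<open>
  The classes in question are the levels of the cumulative hierarchy: a set of rank \<open>b\<close> is a subset
  of the class of sets of rank less than \<open>b\<close>.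
\<close>
lemma is_set_rank_less:
  "is_set {x::'v::zfc. collapse (mem_rel\<^sup>+) x \<in> elts a}"
proof (induction a rule: wf_induct_rule[OF foundation])
  case (1 a)
  let ?r = "collapse (mem_rel\<^sup>+ :: ('v \<times> 'v) set)"
  have r: "elts (?r x) = ?r ` trcl x" for x
    using elts_collapse[OF wf_trancl[OF foundation], of x] is_set_trcl[of x] by (simp add: trcl_eq)
  have "is_set (\<Union>b\<in>elts a. {x. elts x \<subseteq> {y. ?r y \<in> elts b}})"
    using 1 by (intro is_set_UN is_set_Pow is_set_elts) simp
  then show ?case
    by (rule is_set_subset) (use r mem_trcl in blast)
qed

text \<open>
  The rank of \<open>x\<close> is an ordinal onto which \<open>trcl x\<close> maps, so it cannot include \<open>\<kappa>\<close> if \<open>trcl x\<close> is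
  smaller than \<open>\<kappa>\<close>. Hence \<open>H \<kappa>\<close> is contained in a level of the cumulative hierarchy.
\<close>
lemma is_set_H:
  assumes "Ord (\<kappa>::'v::zfc)" shows "is_set (H \<kappa>)"
proof (rule is_set_subset[OF is_set_rank_less[of \<kappa>]], rule subsetI, rule CollectI, rule ccontr)
  let ?r = "collapse (mem_rel\<^sup>+ :: ('v \<times> 'v) set)"
  fix x assume x: "x \<in> H \<kappa>" and n: "?r x \<notin> elts \<kappa>"
  have sets: "is_set {e. (e, d) \<in> mem_rel\<^sup>+}" for d :: 'v
    using is_set_trcl[of d] by (simp add: trcl_eq)
  have "Ord (?r x)" by (rule Ord_collapse[OF wf_trancl[OF foundation] trans_trancl sets])
  then have "elts \<kappa> \<subseteq> elts (?r x)" using n Ord_mem_iff_not_subset assms by blast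
  also have "elts (?r x) = ?r ` trcl x"
    using elts_collapse[OF wf_trancl[OF foundation] sets, of x] by (simp add: trcl_eq)
  finally have "elts \<kappa> \<lesssim> trcl x" by (rule subset_image_lepoll)
  moreover have "trcl x \<prec> elts \<kappa>" using x by (simp add: H_def)
  ultimately show False using lesspoll_trans1 lesspoll_not_refl by blast
qed

lemma regular_subset_H: "regular (\<kappa>::'v::zfc) \<Longrightarrow> elts \<kappa> \<subseteq> H \<kappa>"
proof
  fix b assume k: "regular \<kappa>" and b: "b \<in> elts \<kappa>"
  have O: "Ord \<kappa>" using k unfolding regular_def by blast
  have "elts b \<subseteq> elts \<kappa>" using OrdD[OF O b] by blast
  then have "elts b \<prec> elts \<kappa>"
    unfolding lesspoll_def using regular_not_lepoll[OF k b] by (metis eqpoll_imp_lepoll eqpoll_sym subset_imp_lepoll)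
  then show "b \<in> H \<kappa>" using trcl_Ord[OF Ord_mem[OF O b]] by (simp add: H_def)
qed

lemma H_mono_lepoll:
  "trcl x \<lesssim> elts d \<Longrightarrow> \<not> elts t \<lesssim> elts d \<Longrightarrow> x \<in> H t"
  unfolding H_def lesspoll_def using lepoll_total[of "elts t" "elts d"]
  by (metis eqpoll_sym lepoll_trans lepoll_trans1 mem_Collect_eq)

text \<open>
  Take the successor cardinal of a set that includes \<open>\<kappa>\<close> and all transitive closures of elements of
  \<open>X\<close>.
\<close>
lemma ex_regular_H:
  assumes "is_set (X::'v::zfc set)" "Ord \<kappa>"
  shows "\<exists>\<theta>. regular \<theta> \<and> X \<subseteq> H \<theta> \<and> H \<kappa> \<subseteq> H \<theta>"
proof -
  define d where "d = vset ((\<Union>x\<in>X. trcl x) \<union> (elts \<kappa> \<union> elts omega))"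
  have d: "elts d = (\<Union>x\<in>X. trcl x) \<union> (elts \<kappa> \<union> elts omega)"
    unfolding d_def by (intro elts_vset is_set_Un is_set_UN is_set_trcl is_set_elts assms(1))
  have inf: "infinite (elts d)" unfolding d using omega(2) by blast
  note t = regular_least_not_lepoll[OF inf]
  let ?t = "ord_least (\<lambda>a::'v. \<not> elts a \<lesssim> elts d)"
  have "X \<subseteq> H ?t"
  proof
    fix x assume "x \<in> X"
    then have "trcl x \<lesssim> elts d" by (intro subset_imp_lepoll) (auto simp: d)
    then show "x \<in> H ?t" using t(2) by (rule H_mono_lepoll)
  qed
  moreover have "H \<kappa> \<subseteq> H ?t"
  proof
    fix x assume "x \<in> H \<kappa>"
    then have "trcl x \<lesssim> elts \<kappa>" by (simp add: H_def lesspoll_def)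
    also have "elts \<kappa> \<lesssim> elts d" by (intro subset_imp_lepoll) (auto simp: d)
    finally show "x \<in> H ?t" using t(2) by (rule H_mono_lepoll)
  qed
  ultimately show ?thesis using t(1) by blast
qed

section \<open>Clubs of countable and of \<open>\<omega>\<^sub>1\<close>-sized sets\<close>

lemma stationary_subsetsD:
  "stationary_subsets \<mu> P S \<Longrightarrow> club_subsets \<mu> P C \<Longrightarrow> \<exists>x. x \<in> S \<and> x \<in> C"
  unfolding stationary_subsets_def by blast

lemma UN_subsets_omega:
  fixes f :: "'v::zfc \<Rightarrow> 'v"
  assumes "Ord (a::'v::zfc)" "elts a \<lesssim> elts (omega::'v)" "\<forall>\<xi>\<in>elts a. f \<xi> \<in> subsets_omega Y"
  shows "vset (\<Union>\<xi>\<in>elts a. elts (f \<xi>)) \<in> subsets_omega Y"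
proof -
  have "countable (elts a)" using assms(2) countable_iff_lepoll_omega by metis
  then show ?thesis using assms(3)
    by (auto simp: subsets_omega_def elts_vset_UN)
qed

lemma club_subsets_omega_self: "club_subsets omega (subsets_omega Y) (subsets_omega (Y::'v::zfc set))"
  unfolding club_subsets_def by (auto intro: UN_subsets_omega)

text \<open>
  The Skolem hull argument, with a set-valued \<open>G\<close> in place of a family of \<open>\<omega>\<^sub>1\<close> many functions.
\<close>
lemma closure_club_omega1:
  fixes G :: "'v::zfc \<Rightarrow> 'v set"
  assumes G: "\<And>u. u \<in> Y \<Longrightarrow> G u \<subseteq> Y" "\<And>u. u \<in> Y \<Longrightarrow> G u \<lesssim> elts (omega1::'v)"
  shows "club_subsets omega1 (subsets_omega1 Y) {W \<in> subsets_omega1 Y. \<forall>u\<in>elts W. G u \<subseteq> elts W}"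
    (is "club_subsets omega1 ?P ?C")
  unfolding club_subsets_def
proof (intro conjI ballI allI impI)
  note inf = infinite_omega1[where 'v='v]
  show "?C \<subseteq> ?P" by blast
  fix x assume x: "x \<in> ?P"
  define A where "A n = ((\<lambda>X. X \<union> (\<Union>u\<in>X. G u)) ^^ n) (elts x)" for n
  have A_Suc: "A (Suc n) = A n \<union> (\<Union>u\<in>A n. G u)" for n by (simp add: A_def)
  have A0: "A 0 = elts x" by (simp add: A_def)
  have A: "A n \<subseteq> Y \<and> A n \<lesssim> elts (omega1::'v)" for n
  proof (induction n)
    case 0
    then show ?case using x by (auto simp: A0 subsets_omega1_def eqpoll_imp_lepoll)
  next
    case (Suc n)
    then have "(\<Union>u\<in>A n. G u) \<lesssim> elts (omega1::'v)"
      using G by (intro UN_lepoll_infinite[OF inf]) auto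
    moreover have "(\<Union>u\<in>A n. G u) \<subseteq> Y" using Suc G(1) by blast
    ultimately show ?case using Suc by (auto simp: A_Suc intro: Un_lepoll_infinite[OF inf])
  qed
  have le: "(\<Union>n. A n) \<lesssim> elts (omega1::'v)"
    using A by (intro UN_lepoll_infinite[OF inf]) (auto simp: countable_lepoll_infinite inf)
  define y where "y = vset (\<Union>n. A n)"
  have y: "elts y = (\<Union>n. A n)" unfolding y_def using is_set_lepoll[OF le] by (rule elts_vset)
  have xy: "elts x \<subseteq> elts y" using A0 y by blast
  have "elts (omega1::'v) \<lesssim> elts x" using x by (simp add: subsets_omega1_def eqpoll_imp_lepoll eqpoll_sym)
  then have "elts y \<approx> elts (omega1::'v)"
    using le xy y by (metis lepoll_antisym lepoll_trans subset_imp_lepoll)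
  moreover have "G u \<subseteq> elts y" if u: "u \<in> elts y" for u
  proof -
    obtain n where "u \<in> A n" using u y by blast
    then have "G u \<subseteq> A (Suc n)" using A_Suc by blast
    then show ?thesis using y by blast
  qed
  ultimately have "y \<in> ?C" using A y by (auto simp: subsets_omega1_def)
  then show "\<exists>y\<in>?C. elts x \<subseteq> elts y" using xy by blast
next
  note inf = infinite_omega1[where 'v='v]
  fix a :: 'v and f
  assume a: "Ord a \<and> elts a \<noteq> {} \<and> elts a \<lesssim> elts (omega1::'v) \<and> (\<forall>\<xi>\<in>elts a. f \<xi> \<in> ?C) \<and>
       (\<forall>\<eta>\<in>elts a. \<forall>\<xi>\<in>elts \<eta>. elts (f \<xi>) \<subseteq> elts (f \<eta>))"
  let ?U = "\<Union>\<xi>\<in>elts a. elts (f \<xi>)"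
  have f: "elts (f \<xi>) \<approx> elts (omega1::'v)" "elts (f \<xi>) \<subseteq> Y" "\<And>u. u \<in> elts (f \<xi>) \<Longrightarrow> G u \<subseteq> elts (f \<xi>)"
    if "\<xi> \<in> elts a" for \<xi>
    using a that by (auto simp: subsets_omega1_def)
  have "?U \<lesssim> elts (omega1::'v)"
    using a f(1) by (intro UN_lepoll_infinite[OF inf]) (auto intro: eqpoll_imp_lepoll)
  moreover obtain z where z: "z \<in> elts a" using a by blast
  have "elts (omega1::'v) \<lesssim> elts (f z)" using f(1)[OF z] by (simp add: eqpoll_imp_lepoll eqpoll_sym)
  then have "elts (omega1::'v) \<lesssim> ?U" using z by (meson UN_upper lepoll_trans subset_imp_lepoll)
  ultimately have "?U \<approx> elts (omega1::'v)" by (rule lepoll_antisym)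
  then have "vset ?U \<in> subsets_omega1 Y" using f(2) by (auto simp: subsets_omega1_def elts_vset_UN)
  moreover have "\<forall>u\<in>?U. G u \<subseteq> ?U" using f(3) by blast
  ultimately show "vset ?U \<in> ?C" by (simp add: elts_vset_UN)
qed

section \<open>Reflection of lifts\<close>

lemma unbounded_inD:
  "unbounded_in \<gamma> A \<Longrightarrow> \<xi> \<in> elts \<gamma> \<Longrightarrow> \<exists>\<eta>\<in>A. \<eta> \<in> elts \<gamma> \<and> \<xi> \<in> elts \<eta>"
  unfolding unbounded_in_def by blast

text \<open>
  This is the reason why stationarity passes from \<open>[X]\<^sup>\<omega>\<close> down to ordinals. The projection
  \<open>x \<mapsto> sup(x \<inter> \<kappa>)\<close> sends unions to suprema, and it takes values below \<open>\<gamma>\<close> because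
  \<open>cf(\<gamma>) > \<omega>\<close>. So preimages of closed sets are closed, and the preimage of a club is cofinal by
  an interleaving argument.
\<close>
lemma lift_club:
  fixes \<gamma> :: "'v::zfc"
  assumes O: "Ord \<kappa>" and X: "X \<inter> elts \<kappa> \<subseteq> elts \<gamma>" "unbounded_in \<gamma> (X \<inter> elts \<kappa>)"
    and cof: "Ord \<gamma>" "omega \<in> elts (cof \<gamma>)" and D: "club_in \<gamma> D"
  shows "club_subsets omega (subsets_omega X)
    {x \<in> subsets_omega X. ord_sup (elts x \<inter> elts \<kappa>) \<in> D}" (is "club_subsets omega ?P ?C")
  unfolding club_subsets_def
proof (intro conjI ballI allI impI)
  note sup = ord_sup_countable_mem[OF cof]
  have D': "D \<subseteq> elts \<gamma>" "\<And>\<delta>. \<delta> \<in> elts \<gamma> \<Longrightarrow> elts \<delta> \<noteq> {} \<Longrightarrow> unbounded_in \<delta> D \<Longrightarrow> \<delta> \<in> D"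
    "unbounded_in \<gamma> D"
    using D by (auto simp: club_in_def)
  have xg: "ord_sup (elts x \<inter> elts \<kappa>) \<in> elts \<gamma>" if "x \<in> ?P" for x
    using that X(1) by (intro sup) (auto simp: subsets_omega_def)
  show "?C \<subseteq> ?P" by blast
  fix x assume x: "x \<in> ?P"
  \<comment> \<open>Interleave points of \<open>D\<close> with points of \<open>X \<inter> \<kappa>\<close>, starting above \<open>x \<inter> \<kappa>\<close>, and add the latter
     to \<open>x\<close>; the new supremum is a limit of \<open>D\<close>.\<close>
  have "\<exists>b. b \<in> X \<inter> elts \<kappa> \<and> (\<exists>d\<in>D. \<xi> \<in> elts d \<and> d \<in> elts b)" if "\<xi> \<in> elts \<gamma>" for \<xi>
    using unbounded_inD[OF D'(3) that] unbounded_inD[OF X(2)] by blast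
  then obtain s where s: "\<And>\<xi>. \<xi> \<in> elts \<gamma> \<Longrightarrow> s \<xi> \<in> X \<inter> elts \<kappa>"
      "\<And>\<xi>. \<xi> \<in> elts \<gamma> \<Longrightarrow> \<exists>d\<in>D. \<xi> \<in> elts d \<and> d \<in> elts (s \<xi>)" by metis
  define b where "b n = (s ^^ n) (ord_sup (elts x \<inter> elts \<kappa>))" for n
  have b: "b n \<in> elts \<gamma>" for n
  proof (induction n)
    case 0 then show ?case using xg[OF x] by (simp add: b_def)
  next
    case (Suc n) then show ?case using s(1) X(1) by (auto simp: b_def)
  qed
  have Suc: "b (Suc n) = s (b n)" for n by (simp add: b_def)
  define y where "y = vset (elts x \<union> range (\<lambda>n. b (Suc n)))"
  have "countable (elts x \<union> range (\<lambda>n. b (Suc n)))" using x by (auto simp: subsets_omega_def)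
  then have y: "elts y = elts x \<union> range (\<lambda>n. b (Suc n))"
    unfolding y_def by (intro elts_vset) (metis countable_iff_lepoll_omega is_set_lepoll)
  have yP: "y \<in> ?P" using x s(1) b by (auto simp: subsets_omega_def y Suc)
  let ?d = "ord_sup (elts y \<inter> elts \<kappa>)"
  have d: "elts ?d = (\<Union>z\<in>elts y \<inter> elts \<kappa>. elts z)" by (rule elts_ord_sup[OF is_set_Int])
  have bd: "elts (b (Suc n)) \<subseteq> elts ?d" for n
    unfolding d using s(1)[OF b[of n]] by (auto simp: y Suc)
  have below: "\<exists>n. \<xi> \<in> elts (b n)" if \<xi>: "\<xi> \<in> elts ?d" for \<xi>
  proof -
    obtain z where z: "z \<in> elts y" "z \<in> elts \<kappa>" "\<xi> \<in> elts z" using \<xi> d by blast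
    show ?thesis
    proof (cases "z \<in> elts x")
      case True
      then have "\<xi> \<in> elts (b 0)" using z by (auto simp: b_def elts_ord_sup[OF is_set_Int])
      then show ?thesis by blast
    qed (use z y in auto)
  qed
  have next_D: "\<exists>e\<in>D. e \<in> elts ?d \<and> b n \<in> elts e" for n
    using s(2)[OF b[of n]] bd[of n] by (auto simp: Suc)
  have "?d \<in> D"
  proof (rule D'(2)[OF xg[OF yP]])
    show "elts ?d \<noteq> {}" using next_D by blast
    show "unbounded_in ?d D"
      unfolding unbounded_in_def
    proof
      fix \<xi> assume "\<xi> \<in> elts ?d"
      then obtain n where "\<xi> \<in> elts (b n)" using below by blast
      moreover obtain e where e: "e \<in> D" "e \<in> elts ?d" "b n \<in> elts e" using next_D by blast
      moreover have "Ord e" using e(1) D'(1) Ord_mem[OF cof(1)] by blast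
      ultimately have "\<xi> \<in> elts e" using OrdD by blast
      then show "\<exists>\<eta>\<in>D \<inter> elts ?d. \<xi> \<in> elts \<eta>" using e by blast
    qed
  qed
  then show "\<exists>y\<in>?C. elts x \<subseteq> elts y" using yP y by blast
next
  have D': "D \<subseteq> elts \<gamma>" "\<And>\<delta>. \<delta> \<in> elts \<gamma> \<Longrightarrow> elts \<delta> \<noteq> {} \<Longrightarrow> unbounded_in \<delta> D \<Longrightarrow> \<delta> \<in> D"
    using D by (auto simp: club_in_def)
  fix a :: 'v and f
  assume a: "Ord a \<and> elts a \<noteq> {} \<and> elts a \<lesssim> elts (omega::'v) \<and> (\<forall>\<xi>\<in>elts a. f \<xi> \<in> ?C) \<and>
       (\<forall>\<eta>\<in>elts a. \<forall>\<xi>\<in>elts \<eta>. elts (f \<xi>) \<subseteq> elts (f \<eta>))"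
  define y where "y = vset (\<Union>\<xi>\<in>elts a. elts (f \<xi>))"
  have y: "elts y = (\<Union>\<xi>\<in>elts a. elts (f \<xi>))" unfolding y_def by (rule elts_vset_UN)
  have yP: "y \<in> ?P" unfolding y_def by (rule UN_subsets_omega) (use a in auto)
  let ?d = "ord_sup (elts y \<inter> elts \<kappa>)"
  let ?e = "\<lambda>\<xi>. ord_sup (elts (f \<xi>) \<inter> elts \<kappa>)"
  have d: "elts ?d = (\<Union>\<xi>\<in>elts a. elts (?e \<xi>))" unfolding elts_ord_sup[OF is_set_Int] by (auto simp: y)
  have dg: "?d \<in> elts \<gamma>"
    using yP X(1) by (intro ord_sup_countable_mem[OF cof]) (auto simp: subsets_omega_def)
  have eD: "?e \<xi> \<in> D" if "\<xi> \<in> elts a" for \<xi> using a that by auto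
  have "?d \<in> D"
  proof (cases "\<exists>\<xi>\<in>elts a. ?e \<xi> = ?d")
    case True then show ?thesis using eD by metis
  next
    case False
    \<comment> \<open>Now the supremum is not attained, hence a limit of the points \<open>?e \<xi>\<close> of \<open>D\<close>.\<close>
    have ed: "?e \<xi> \<in> elts ?d" if "\<xi> \<in> elts a" for \<xi>
    proof (rule Ord_psubset_mem)
      show "Ord (?e \<xi>)" "Ord ?d" using eD[OF that] dg D'(1) Ord_mem[OF cof(1)] by blast+
      show "elts (?e \<xi>) \<subseteq> elts ?d" using d that by blast
      show "?e \<xi> \<noteq> ?d" using False that by blast
    qed
    show ?thesis
    proof (rule D'(2)[OF dg])
      show "elts ?d \<noteq> {}" using ed a by blast
      show "unbounded_in ?d D" unfolding unbounded_in_def using d ed eD by blast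
    qed
  qed
  then show "vset (\<Union>\<xi>\<in>elts a. elts (f \<xi>)) \<in> ?C" using yP y_def by simp
qed

lemma stationary_in_of_lift:
  fixes \<gamma> :: "'v::zfc"
  assumes "Ord \<kappa>" "X \<inter> elts \<kappa> \<subseteq> elts \<gamma>" "unbounded_in \<gamma> (X \<inter> elts \<kappa>)"
    and "Ord \<gamma>" "omega \<in> elts (cof \<gamma>)"
    and st: "stationary_subsets omega (subsets_omega X) S" and S: "S \<subseteq> lift \<kappa> A"
  shows "stationary_in \<gamma> (A \<inter> elts \<gamma>)"
  unfolding stationary_in_def
proof (intro conjI allI impI)
  show "A \<inter> elts \<gamma> \<subseteq> elts \<gamma>" by blast
  fix D assume D: "club_in \<gamma> D"
  obtain x where "x \<in> S" "ord_sup (elts x \<inter> elts \<kappa>) \<in> D"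
    using stationary_subsetsD[OF st lift_club[OF assms(1-5) D]] by blast
  moreover have "D \<subseteq> elts \<gamma>" using D by (simp add: club_in_def)
  ultimately show "A \<inter> elts \<gamma> \<inter> D \<noteq> {}" using S by (auto simp: lift_def)
qed

section \<open>Continuous \<open>\<omega>\<^sub>1\<close>-chains\<close>

lemma Limit_sup:
  assumes L: "L \<subseteq> elts (omega1::'v::zfc)" "L \<noteq> {}" "\<And>l. l \<in> L \<Longrightarrow> Limit l"
    and b: "b \<in> elts omega1" "\<And>l. l \<in> L \<Longrightarrow> elts l \<subseteq> elts b"
  shows "ord_sup L \<in> elts omega1" "Limit (ord_sup L)" "elts (ord_sup L) = (\<Union>l\<in>L. elts l)"
proof -
  have s: "is_set L" using is_set_subset[OF is_set_elts L(1)] .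
  show e: "elts (ord_sup L) = (\<Union>l\<in>L. elts l)" by (rule elts_ord_sup[OF s])
  have O: "Ord (ord_sup L)" using L(3) by (intro Ord_ord_sup[OF s]) (simp add: Limit_def)
  have Ob: "Ord b" using Ord_mem[OF omega1(1) b(1)] .
  have "elts (ord_sup L) \<subseteq> elts b" using e b(2) by blast
  then show "ord_sup L \<in> elts omega1" using O Ob b(1) omega1(3) countable_subset by metis
  show "Limit (ord_sup L)" unfolding Limit_def using O L(2,3) by (auto simp: e Limit_def)
qed

text \<open>
  The function \<open>d\<close> lives on the countable limit ordinals and is weakly increasing, continuous and
  cofinal in \<open>\<gamma>\<close>. Since countably many indices have a common countable bound, \<open>\<gamma>\<close> has uncountable
  cofinality; since \<open>d\<close> is continuous, its range is closed. Only limit indices are used, because the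
  members of an \<open>\<in>\<close>-chain need not increase at successor steps.
\<close>
lemma omega1_chain:
  fixes d :: "'v::zfc \<Rightarrow> 'v"
  defines "\<Lambda> \<equiv> {l \<in> elts omega1. Limit l}"
  assumes O: "Ord \<gamma>"
    and mem: "\<And>l. l \<in> \<Lambda> \<Longrightarrow> d l \<in> elts \<gamma>"
    and cofinal: "\<And>\<xi>. \<xi> \<in> elts \<gamma> \<Longrightarrow> \<exists>l\<in>\<Lambda>. \<xi> \<in> elts (d l)"
    and mono: "\<And>k l. k \<in> \<Lambda> \<Longrightarrow> l \<in> \<Lambda> \<Longrightarrow> elts k \<subseteq> elts l \<Longrightarrow> elts (d k) \<subseteq> elts (d l)"
    and cont: "\<And>L l. L \<subseteq> \<Lambda> \<Longrightarrow> l \<in> \<Lambda> \<Longrightarrow> elts l = (\<Union>k\<in>L. elts k) \<Longrightarrow> elts (d l) = (\<Union>k\<in>L. elts (d k))"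
  shows "omega \<in> elts (cof \<gamma>)" "club_in \<gamma> (d ` \<Lambda>)"
proof -
  show "omega \<in> elts (cof \<gamma>)"
  proof (rule ccontr)
    assume "omega \<notin> elts (cof \<gamma>)"
    then have "elts (cof \<gamma>) \<subseteq> elts omega"
      using Ord_mem_iff_not_subset[OF omega(1) Ord_cof[OF O]] by blast
    then have c: "countable (elts (cof \<gamma>))" using omega(3) countable_subset by blast
    obtain f where f: "\<forall>\<eta>\<in>elts (cof \<gamma>). f \<eta> \<in> elts \<gamma>"
        "\<forall>\<xi>\<in>elts \<gamma>. \<exists>\<eta>\<in>elts (cof \<gamma>). elts \<xi> \<subseteq> elts (f \<eta>)"
      using ex_cofinal[OF O] by blast
    then have "\<forall>\<eta>\<in>elts (cof \<gamma>). \<exists>l\<in>\<Lambda>. f \<eta> \<in> elts (d l)" using cofinal by blast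
    then obtain g where g: "\<And>\<eta>. \<eta> \<in> elts (cof \<gamma>) \<Longrightarrow> g \<eta> \<in> \<Lambda> \<and> f \<eta> \<in> elts (d (g \<eta>))" by metis
    let ?L = "g ` elts (cof \<gamma>)"
    have s: "is_set ?L" by (simp add: is_set_image)
    have "?L \<subseteq> elts omega1" using g \<Lambda>_def by blast
    then have OL: "Ord x \<and> countable (elts x)" if "x \<in> ?L" for x
      using that Ord_mem[OF omega1(1)] omega1(3) by blast
    have "countable (elts (ord_sup ?L))" using c OL by (auto simp: elts_ord_sup[OF s])
    moreover have "Ord (ord_sup ?L)" using OL by (intro Ord_ord_sup[OF s]) blast
    ultimately have "ord_sup ?L \<in> elts omega1" using omega1(3) by blast
    then obtain m where m: "m \<in> elts omega1" "Limit m" "ord_sup ?L \<in> elts m"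
      using Limit_above_in_omega1 by blast
    then have mL: "m \<in> \<Lambda>" by (simp add: \<Lambda>_def)
    obtain \<eta> where \<eta>: "\<eta> \<in> elts (cof \<gamma>)" "elts (d m) \<subseteq> elts (f \<eta>)" using f(2) mem[OF mL] by blast
    have "elts (g \<eta>) \<subseteq> elts m"
      using m \<eta>(1) OrdD[of m "ord_sup ?L"] by (auto simp: elts_ord_sup[OF s] Limit_def)
    then have "elts (d (g \<eta>)) \<subseteq> elts (d m)" using mono g[OF \<eta>(1)] mL by blast
    then have "f \<eta> \<in> elts (f \<eta>)" using g[OF \<eta>(1)] \<eta>(2) by blast
    then show False using mem_irrefl by blast
  qed
  show "club_in \<gamma> (d ` \<Lambda>)"
    unfolding club_in_def
  proof (intro conjI ballI impI)
    show "d ` \<Lambda> \<subseteq> elts \<gamma>" using mem by blast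
    show "unbounded_in \<gamma> (d ` \<Lambda>)" unfolding unbounded_in_def using mem cofinal by blast
    fix \<delta> assume \<delta>: "\<delta> \<in> elts \<gamma>" "elts \<delta> \<noteq> {} \<and> unbounded_in \<delta> (d ` \<Lambda>)"
    \<comment> \<open>The limit point \<open>\<delta>\<close> is the value at the supremum of the indices whose values lie below it.\<close>
    define L where "L = {l \<in> \<Lambda>. d l \<in> elts \<delta>}"
    obtain b where b: "b \<in> \<Lambda>" "\<delta> \<in> elts (d b)" using cofinal[OF \<delta>(1)] by blast
    have \<Lambda>O: "Ord l" if "l \<in> \<Lambda>" for l using that by (simp add: \<Lambda>_def Limit_def)
    have dO: "Ord (d l)" if "l \<in> \<Lambda>" for l using Ord_mem[OF O mem[OF that]] .
    have \<delta>O: "Ord \<delta>" using Ord_mem[OF O \<delta>(1)] .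
    have Lb: "elts l \<subseteq> elts b" if "l \<in> L" for l
    proof (rule ccontr)
      assume "\<not> elts l \<subseteq> elts b"
      then have "elts b \<subseteq> elts l"
        using that b \<Lambda>O Ord_mem_iff_not_subset L_def OrdD by (metis (no_types, lifting) mem_Collect_eq subsetI)
      then have "elts (d b) \<subseteq> elts (d l)" using mono b that L_def by blast
      then have "\<delta> \<in> elts (d l)" using b by blast
      then show False using that mem_asym L_def by blast
    qed
    have next_L: "\<exists>l\<in>L. \<xi> \<in> elts (d l)" if "\<xi> \<in> elts \<delta>" for \<xi>
      using \<delta>(2) that unbounded_inD[of \<delta> "d ` \<Lambda>" \<xi>] by (auto simp: L_def)
    then have "L \<noteq> {}" using \<delta>(2) by blast
    define m where "m = ord_sup L"
    have m: "m \<in> elts omega1" "Limit m" "elts m = (\<Union>l\<in>L. elts l)"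
      unfolding m_def by (rule Limit_sup[where b=b]; use \<open>L \<noteq> {}\<close> Lb b in \<open>auto simp: L_def \<Lambda>_def\<close>)+
    then have mL: "m \<in> \<Lambda>" by (simp add: \<Lambda>_def)
    have "m \<notin> L"
    proof
      assume "m \<in> L"
      then obtain l where "l \<in> L" "d m \<in> elts (d l)" using next_L L_def by blast
      moreover have "elts (d l) \<subseteq> elts (d m)" using mono[of l m] mL m(3) \<open>l \<in> L\<close> L_def by blast
      ultimately show False using mem_irrefl by blast
    qed
    then have "elts (d m) = (\<Union>k\<in>L. elts (d k))" using cont[of L m] mL m(3) L_def by blast
    also have "\<dots> = elts \<delta>" using next_L OrdD[OF \<delta>O] by (auto simp: L_def)
    finally have "d m = \<delta>" by (rule extensionality)
    then show "\<delta> \<in> d ` \<Lambda>" using mL by blast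
  qed
qed


text \<open>
  The club is \<open>{sup(N\<^sub>\<lambda> \<inter> \<kappa>) | \<lambda> < \<omega>\<^sub>1 limit}\<close> for an approaching chain \<open>N\<close> of \<open>X\<close>. Each \<open>N\<^sub>\<lambda>\<close> is an
  element of \<open>N\<^bsub>\<lambda>+1\<^esub> \<subseteq> X\<close>, so that the closure assumption on \<open>X\<close> puts its supremum into \<open>X\<close>. This is
  the step that turns a statement about the indices in \<open>X\<close> into one about a club of indices.
\<close>
lemma internally_approachable_club:
  fixes \<gamma> :: "'v::zfc"
  assumes O\<gamma>: "Ord \<gamma>" and IA: "internally_approachable X"
    and below: "X \<inter> elts \<kappa> \<subseteq> elts \<gamma>" and unb: "unbounded_in \<gamma> (X \<inter> elts \<kappa>)"
    and sup: "\<And>x. x \<in> X \<Longrightarrow> elts x \<subseteq> X \<Longrightarrow> countable (elts x) \<Longrightarrow>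
                ord_sup (elts x \<inter> elts \<kappa>) \<in> X \<inter> elts \<kappa>"
  shows "omega \<in> elts (cof \<gamma>) \<and> (\<exists>F\<subseteq>X \<inter> elts \<kappa>. club_in \<gamma> F)"
proof -
  obtain f :: "'v \<Rightarrow> 'v" where fX: "X = (\<Union>\<alpha>\<in>elts omega1. elts (f \<alpha>))"
    and fall: "\<forall>\<alpha>\<in>elts omega1. countable (elts (f \<alpha>)) \<and> f \<alpha> \<in> elts (f (ord_succ \<alpha>)) \<and>
           (Limit \<alpha> \<longrightarrow> elts (f \<alpha>) = (\<Union>\<xi>\<in>elts \<alpha>. elts (f \<xi>))) \<and> vseq f \<alpha> \<in> X"
    using IA unfolding internally_approachable_def by (elim exE conjE) (rule that)
  have f: "X = (\<Union>\<alpha>\<in>elts omega1. elts (f \<alpha>))"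
      "\<And>\<alpha>. \<alpha> \<in> elts omega1 \<Longrightarrow> countable (elts (f \<alpha>))"
      "\<And>\<alpha>. \<alpha> \<in> elts omega1 \<Longrightarrow> f \<alpha> \<in> elts (f (ord_succ \<alpha>))"
      "\<And>\<alpha>. \<alpha> \<in> elts omega1 \<Longrightarrow> Limit \<alpha> \<Longrightarrow> elts (f \<alpha>) = (\<Union>\<xi>\<in>elts \<alpha>. elts (f \<xi>))"
    using fX bspec[OF fall] by simp_all
  define d where "d \<alpha> = ord_sup (elts (f \<alpha>) \<inter> elts \<kappa>)" for \<alpha>
  have ed: "elts (d \<alpha>) = (\<Union>x\<in>elts (f \<alpha>) \<inter> elts \<kappa>. elts x)" for \<alpha>
    unfolding d_def by (rule elts_ord_sup[OF is_set_Int])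
  have dX: "d \<alpha> \<in> X \<inter> elts \<kappa>" if \<alpha>: "\<alpha> \<in> elts omega1" for \<alpha>
  proof -
    have Oa: "Ord \<alpha>" "countable (elts \<alpha>)" using \<alpha> omega1(1,3) Ord_mem by metis+
    then have "ord_succ \<alpha> \<in> elts omega1"
      using omega1(3)[OF Ord_ord_succ[OF Oa(1)]] by (simp add: elts_ord_succ)
    then have "f \<alpha> \<in> X" using f(1) f(3)[OF \<alpha>] by blast
    moreover have "elts (f \<alpha>) \<subseteq> X" using f(1) \<alpha> by blast
    ultimately show ?thesis unfolding d_def using f(2)[OF \<alpha>] by (rule sup)
  qed
  let ?\<Lambda> = "{l \<in> elts omega1. Limit l} :: 'v set"
  have f_mono: "elts (f \<xi>) \<subseteq> elts (f l)" if "l \<in> ?\<Lambda>" "\<xi> \<in> elts l" for l \<xi>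
    using f(4)[of l] that by blast
  have mem: "d l \<in> elts \<gamma>" if "l \<in> ?\<Lambda>" for l using dX below that by blast
  have cofinal: "\<exists>l\<in>?\<Lambda>. \<xi> \<in> elts (d l)" if \<xi>: "\<xi> \<in> elts \<gamma>" for \<xi>
  proof -
    obtain x where x: "x \<in> X" "x \<in> elts \<kappa>" "\<xi> \<in> elts x" using unbounded_inD[OF unb \<xi>] by blast
    then obtain \<alpha> where \<alpha>: "\<alpha> \<in> elts omega1" "x \<in> elts (f \<alpha>)" using f(1) by blast
    obtain l where l: "l \<in> elts omega1" "Limit l" "\<alpha> \<in> elts l"
      using Limit_above_in_omega1[OF \<alpha>(1)] by blast
    then have "\<xi> \<in> elts (d l)" using f_mono[of l \<alpha>] \<alpha> x ed by blast
    then show ?thesis using l by blast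
  qed
  have mono: "elts (d k) \<subseteq> elts (d l)" if "k \<in> ?\<Lambda>" "l \<in> ?\<Lambda>" "elts k \<subseteq> elts l" for k l
  proof -
    have "elts (f k) \<subseteq> elts (f l)" using f(4)[of k] f(4)[of l] that by blast
    then show ?thesis unfolding ed by blast
  qed
  have cont: "elts (d l) = (\<Union>k\<in>L. elts (d k))"
    if "L \<subseteq> ?\<Lambda>" "l \<in> ?\<Lambda>" "elts l = (\<Union>k\<in>L. elts k)" for L l
  proof -
    have "elts (f l) = (\<Union>\<xi>\<in>(\<Union>k\<in>L. elts k). elts (f \<xi>))" using f(4)[of l] that by simp
    also have "\<dots> = (\<Union>k\<in>L. \<Union>\<xi>\<in>elts k. elts (f \<xi>))" by blast
    also have "\<dots> = (\<Union>k\<in>L. elts (f k))" using f(4) that(1) by (intro SUP_cong) auto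
    finally show ?thesis unfolding ed by blast
  qed
  note chain = omega1_chain[of \<gamma> d, OF O\<gamma> mem cofinal mono cont]
  have "omega \<in> elts (cof \<gamma>)" "club_in \<gamma> (d ` ?\<Lambda>)" by (rule chain; assumption)+
  moreover have "d ` ?\<Lambda> \<subseteq> X \<inter> elts \<kappa>" using dX by blast
  ultimately show ?thesis by blast
qed

section \<open>Diagonal reflection\<close>

theorem theorem6p11:
  fixes \<kappa> :: "'v::zfc"
  assumes "regular \<kappa>" and "omega1 \<in> elts \<kappa>"
    and "wDRP_IA \<kappa> (S_lift \<kappa>)"
  shows "DSR \<kappa> omega1 (S_cof \<kappa> omega)"
  unfolding DSR_def
proof (intro allI impI)
  fix j :: "'v \<Rightarrow> 'v" and T :: "'v \<Rightarrow> 'v \<Rightarrow> 'v set"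
  assume jT: "\<forall>\<alpha>\<in>elts \<kappa>. Ord (j \<alpha>) \<and> elts (j \<alpha>) \<subseteq> elts omega1 \<and>
           (\<forall>i\<in>elts (j \<alpha>). T \<alpha> i \<subseteq> S_cof \<kappa> omega \<and> stationary_in \<kappa> (T \<alpha> i))"
  have O: "Ord \<kappa>" and cof\<kappa>: "cof \<kappa> = \<kappa>" using assms(1) unfolding regular_def by auto
  have "omega \<in> elts (omega1 :: 'v)" using omega1(3) omega by blast
  then have omega_cof: "omega \<in> elts (cof \<kappa>)" using OrdD[OF O assms(2)] cof\<kappa> by simp
  note succ_\<kappa> = regular_ord_succ[OF assms(1)]
  have Hset: "is_set (H \<kappa>)" by (rule is_set_H[OF O])
  have \<kappa>H: "elts \<kappa> \<subseteq> H \<kappa>" by (rule regular_subset_H[OF assms(1)])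
  \<comment> \<open>The club in the definition of \<open>S_lift \<kappa>\<close> is taken to be all of \<open>[H\<^sub>\<kappa>]\<^sup>\<omega>\<close>.\<close>
  define L where "L \<alpha> i = vset (lift \<kappa> (T \<alpha> i) \<inter> subsets_omega (H \<kappa>))" for \<alpha> i
  have Pset: "is_set (subsets_omega (H \<kappa>))"
    by (rule is_set_subset[OF is_set_Pow[OF Hset]]) (auto simp: subsets_omega_def)
  have eL: "elts (L \<alpha> i) = lift \<kappa> (T \<alpha> i)" for \<alpha> i
  proof -
    have "lift \<kappa> (T \<alpha> i) \<inter> subsets_omega (H \<kappa>) = lift \<kappa> (T \<alpha> i)" by (auto simp: lift_def)
    moreover have "is_set (lift \<kappa> (T \<alpha> i))" by (rule is_set_subset[OF Pset]) (auto simp: lift_def)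
    ultimately show ?thesis by (simp add: L_def elts_vset)
  qed
  have LS: "L \<alpha> i \<in> S_lift \<kappa>" if "\<alpha> \<in> elts \<kappa>" "i \<in> elts (j \<alpha>)" for \<alpha> i
    unfolding S_lift_def L_def using jT that club_subsets_omega_self by blast
  have "is_set (S_lift \<kappa>)"
  proof (rule is_set_subset[OF is_set_Pow[OF Pset]], rule subsetI, rule CollectI)
    fix s assume "s \<in> S_lift \<kappa>"
    then obtain A C where s: "s = vset (lift \<kappa> A \<inter> C)" by (auto simp: S_lift_def)
    have sub: "lift \<kappa> A \<inter> C \<subseteq> subsets_omega (H \<kappa>)" by (auto simp: lift_def)
    then show "elts s \<subseteq> subsets_omega (H \<kappa>)" unfolding s 
      using is_set_subset[OF Pset sub] by (simp add: elts_vset)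
  qed
  then obtain \<theta> where \<theta>: "regular \<theta>" "S_lift \<kappa> \<subseteq> H \<theta>" "H \<kappa> \<subseteq> H \<theta>"
    using ex_regular_H O by blast
  \<comment> \<open>Closure of \<open>W\<close> under \<open>G\<close> takes the place of elementarity: the successors make \<open>sup(W \<inter> \<kappa>)\<close> a
     limit of \<open>W \<inter> \<kappa>\<close>, the lifts with index in \<open>W\<close> become subject to reflection, and the suprema of
     an approaching chain become indices in \<open>W\<close>.\<close>
  define G where "G u = (if u \<in> elts \<kappa> then insert (ord_succ u) (L u ` elts (j u)) else {}) \<union>
     (if u \<in> subsets_omega (H \<kappa>) then {ord_sup (elts u \<inter> elts \<kappa>)} else {})" for u
  have sup\<kappa>: "ord_sup (elts u \<inter> elts \<kappa>) \<in> elts \<kappa>" if "countable (elts u)" for u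
    using that by (intro ord_sup_countable_mem[OF O omega_cof]) auto
  have G1: "G u \<subseteq> H \<theta>" for u
  proof -
    have 1: "ord_succ u \<in> H \<theta>" "L u ` elts (j u) \<subseteq> H \<theta>" if "u \<in> elts \<kappa>"
      using succ_\<kappa>[OF that] LS[OF that] \<kappa>H \<theta> by auto
    have 2: "ord_sup (elts u \<inter> elts \<kappa>) \<in> H \<theta>" if "u \<in> subsets_omega (H \<kappa>)"
      using sup\<kappa>[of u] that \<kappa>H \<theta>(3) by (auto simp: subsets_omega_def)
    show ?thesis using 1 2 by (auto simp: G_def)
  qed
  have G2: "G u \<lesssim> elts (omega1 :: 'v)" for u
  proof -
    have fin: "F \<lesssim> elts (omega1 :: 'v)" if "finite F" for F :: "'v set"
      using that infinite_omega1 by (rule finite_lepoll_infinite[rotated])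
    have "L u ` elts (j u) \<lesssim> elts (omega1 :: 'v)" if "u \<in> elts \<kappa>"
      using jT that by (meson image_lepoll lepoll_trans subset_imp_lepoll)
    then have "{ord_succ u} \<union> L u ` elts (j u) \<lesssim> elts (omega1 :: 'v)" if "u \<in> elts \<kappa>"
      using that by (intro Un_lepoll_infinite[OF infinite_omega1] fin[of "{_}"]) auto
    then show ?thesis
      unfolding G_def by (intro Un_lepoll_infinite[OF infinite_omega1]) (auto intro: fin)
  qed
  have "club_subsets omega1 (subsets_omega1 (H \<theta>))
      {W \<in> subsets_omega1 (H \<theta>). \<forall>u\<in>elts W. G u \<subseteq> elts W}"
    by (rule closure_club_omega1) (use G1 G2 in auto)
  from stationary_subsetsD[OF _ this] assms(3) \<theta>(1,2)
  obtain W where W: "W \<in> subsets_omega1 (H \<theta>)"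
     "\<And>u. u \<in> elts W \<Longrightarrow> G u \<subseteq> elts W"
     "internally_approachable (elts W \<inter> H \<kappa>)"
     "\<And>S. S \<in> elts W \<inter> S_lift \<kappa> \<Longrightarrow> stationary_subsets omega (subsets_omega (elts W \<inter> H \<kappa>))
                  (elts S \<inter> subsets_omega (elts W \<inter> H \<kappa>))"
    unfolding wDRP_IA_def by blast
  define X where "X = elts W \<inter> H \<kappa>"
  have XW: "X \<inter> elts \<kappa> = elts W \<inter> elts \<kappa>" using \<kappa>H by (auto simp: X_def)
  define \<gamma> where "\<gamma> = ord_sup (elts W \<inter> elts \<kappa>)"
  have e\<gamma>: "elts \<gamma> = (\<Union>x\<in>elts W \<inter> elts \<kappa>. elts x)" unfolding \<gamma>_def by (rule elts_ord_sup[OF is_set_Int])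
  have W_small: "elts W \<inter> elts \<kappa> \<lesssim> elts (omega1 :: 'v)"
    using W(1) by (auto simp: subsets_omega1_def intro: lepoll_trans[OF subset_imp_lepoll eqpoll_imp_lepoll])
  have \<gamma>\<kappa>: "\<gamma> \<in> elts \<kappa>" unfolding \<gamma>_def
    by (rule ord_sup_mem[OF O _ _ W_small]) (use assms(2) cof\<kappa> in auto)
  have O\<gamma>: "Ord \<gamma>" using Ord_mem[OF O \<gamma>\<kappa>] .
  have W\<gamma>: "\<alpha> \<in> elts \<gamma>" if "\<alpha> \<in> elts W" "\<alpha> \<in> elts \<kappa>" for \<alpha>
  proof -
    have "ord_succ \<alpha> \<in> elts W" using W(2)[OF that(1)] that(2) by (simp add: G_def)
    moreover have "\<alpha> \<in> elts (ord_succ \<alpha>)" by (simp add: elts_ord_succ)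
    ultimately show ?thesis using succ_\<kappa>[OF that(2)] e\<gamma> by blast
  qed
  have unb: "unbounded_in \<gamma> (X \<inter> elts \<kappa>)"
    unfolding unbounded_in_def
  proof
    fix \<xi> assume "\<xi> \<in> elts \<gamma>"
    then obtain x where "x \<in> elts W \<inter> elts \<kappa>" "\<xi> \<in> elts x" using e\<gamma> by blast
    then show "\<exists>\<eta>\<in>X \<inter> elts \<kappa> \<inter> elts \<gamma>. \<xi> \<in> elts \<eta>" using XW W\<gamma> by blast
  qed
  have supX: "ord_sup (elts x \<inter> elts \<kappa>) \<in> X \<inter> elts \<kappa>"
    if "x \<in> X" "elts x \<subseteq> X" "countable (elts x)" for x
  proof -
    have "x \<in> subsets_omega (H \<kappa>)" using that by (auto simp: subsets_omega_def X_def)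
    then have "ord_sup (elts x \<inter> elts \<kappa>) \<in> elts W"
      using W(2)[of x] that(1) by (auto simp: G_def X_def)
    then show ?thesis using sup\<kappa>[OF that(3)] XW by blast
  qed
  obtain F where F: "omega \<in> elts (cof \<gamma>)" "F \<subseteq> X \<inter> elts \<kappa>" "club_in \<gamma> F"
    using internally_approachable_club[OF O\<gamma> W(3)[folded X_def] _ unb supX] XW W\<gamma> by blast
  have "stationary_in \<gamma> (T \<alpha> i \<inter> elts \<gamma>)" if "\<alpha> \<in> F" "i \<in> elts (j \<alpha>)" for \<alpha> i
  proof -
    have \<alpha>: "\<alpha> \<in> elts W" "\<alpha> \<in> elts \<kappa>" using that(1) F(2) XW by blast+
    have "L \<alpha> i \<in> elts W" using W(2)[OF \<alpha>(1)] \<alpha>(2) that(2) by (auto simp: G_def)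
    then have st: "stationary_subsets omega (subsets_omega X) (elts (L \<alpha> i) \<inter> subsets_omega X)"
      using W(4)[of "L \<alpha> i"] LS[OF \<alpha>(2) that(2)] by (auto simp: X_def)
    show ?thesis
      by (rule stationary_in_of_lift[OF O _ unb O\<gamma> F(1) st]) (use XW W\<gamma> eL in auto)
  qed
  then show "\<exists>\<gamma>\<in>elts \<kappa>. omega \<in> elts (cof \<gamma>) \<and> (\<exists>F. club_in \<gamma> F \<and>
                 (\<forall>\<alpha>\<in>F. \<forall>i\<in>elts (j \<alpha>). stationary_in \<gamma> (T \<alpha> i \<inter> elts \<gamma>)))"
    using \<gamma>\<kappa> F(1,3) by blast
qed

end
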